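(* Suppose that $U\le Sp_{2n}(q)$, let $\alpha=2\varepsilon_i$ for some $1\le i\le n$, and let $r\in\mathbb{F}_q^\times$. Let $\zeta=\zeta_{i,-i,r}$ be the supercharacter of $U_{2n}(q)$ associated with $(i,-i)$ and $r$. Then the restriction of $\zeta$ to $U$ is $$\zeta_U=\xi_{\alpha,r}+2\sum_{i<j\le n}\ \sum_{s\in -r^{-1}(\mathbb{F}_q^\times)^2}\xi_{\alpha,r}\,\xi_{2\varepsilon_j,s}.$$
   Context: Let $p\ge 3$ be a prime, $q=p^e$ ($e\ge 1$), $\mathbb{F}_q$ the field with $q$ elements, and $n\ge 1$. Let $U_k(q)$ be the group of unipotent upper-triangular $k\times k$ matrices over $\mathbb{F}_q$, and $U=Sp_{2n}(q)\cap U_{2n}(q)$, a Sylow $p$-subgroup of $Sp_{2n}(q)$. Explicitly, with $J$ the $n\times n$ matrix with 1's on the anti-diagonal and 0's elsewhere, $U$ consists of all block matrices $\begin{pmatrix} x & xz \\ 0 & Jx^{-T}J\end{pmatrix}$ with $x\in U_n(q)$ and $z$ an $n\times n$ matrix over $\mathbb{F}_q$ with $Jz^T-zJ=0$. Rows and columns of $2n\times 2n$ matrices are indexed, in order, by $1,\dots,n,-n,\dots,-1$; this order is denoted $\prec$. $(\mathbb{F}_q^\times)^2$ is the set of nonzero squares in $\mathbb{F}_q$. Fix a nontrivial linear character $\vartheta\colon\mathbb{F}_q^+\to\mathbb{C}^\times$. For the root $\alpha=2\varepsilon_i$ ($1\le i\le n$) and $r\in\mathbb{F}_q^\times$, let $U_\alpha=\{x\in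 U:x_{i,k}=0,\ i<k\le n\}$; then $\lambda_{\alpha,r}(x)=\vartheta(rx_{i,-i})$ is a linear character of $U_\alpha$ and $\xi_{\alpha,r}=(\lambda_{\alpha,r})^U$ is the induced character. The character $\zeta_{i,-i,r}$ of $U_{2n}(q)$ is induced from the linear character $x\mapsto\vartheta(rx_{i,-i})$ of the subgroup $\{x\in U_{2n}(q):x_{i,k}=0,\ i\prec k\prec -i\}$. *)

theory Defs
  imports "HOL-Algebra.Group" "Jordan_Normal_Form.Determinant" Complex_Main
begin

text \<open>
  Matrices over the field with q elements are matrices over a type of classes field and
  finite whose cardinality is q.  All subgroups below live in the group of units of the
  matrix ring.
\<close>

definition GL :: "nat \<Rightarrow> 'a::field mat monoid" where
  "GL k = units_of (ring_mat TYPE('a) k ())"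

definition unitriangular :: "nat \<Rightarrow> 'a::field mat set" where
  "unitriangular k =
     {x \<in> carrier_mat k k. upper_triangular x \<and> (\<forall>a<k. x $$ (a, a) = 1)}"

definition antidiag :: "nat \<Rightarrow> 'a::field mat" where
  "antidiag n = mat n n (\<lambda>(a, b). if a + b + 1 = n then 1 else 0)"

text \<open>
  The symplectic group is the isometry group of the alternating form with Gram matrix
  \<open>(0, J; -J, 0)\<close>, where J is the antidiagonal matrix; this is the choice of form that
  yields the explicit block description proved as \<open>sylow_Sp_block_form\<close> below.
\<close>

definition symp_form :: "nat \<Rightarrow> 'a::field mat" where
  "symp_form n =
     four_block_mat (0\<^sub>m n n) (antidiag n) (- antidiag n) (0\<^sub>m n n)"

definition Sp :: "nat \<Rightarrow> 'a::field mat set" where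
  "Sp n = {x \<in> carrier_mat (2 * n) (2 * n).
             transpose_mat x * symp_form n * x = symp_form n}"

definition sylow_Sp :: "nat \<Rightarrow> 'a::field mat set" where
  "sylow_Sp n = Sp n \<inter> unitriangular (2 * n)"

definition unitriangular_group :: "nat \<Rightarrow> 'a::field mat monoid" where
  "unitriangular_group k = (GL k)\<lparr>carrier := unitriangular k\<rparr>"

definition sylow_Sp_group :: "nat \<Rightarrow> 'a::field mat monoid" where
  "sylow_Sp_group n = (GL (2 * n))\<lparr>carrier := sylow_Sp n\<rparr>"

text \<open>
  Rows and columns of 2n by 2n matrices are indexed by the integers 1, ..., n, -n, ..., -1
  in this order; \<open>pos n k\<close> is the corresponding zero-based position.
\<close>

definition signed_indices :: "nat \<Rightarrow> int set" where
  "signed_indices n = {1..int n} \<union> {- int n..-1}"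

definition pos :: "nat \<Rightarrow> int \<Rightarrow> nat" where
  "pos n k = (if k > 0 then nat (k - 1) else nat (2 * int n + k))"

definition prec :: "nat \<Rightarrow> int \<Rightarrow> int \<Rightarrow> bool" where
  "prec n k l \<longleftrightarrow> pos n k < pos n l"

definition entry :: "nat \<Rightarrow> 'a mat \<Rightarrow> int \<Rightarrow> int \<Rightarrow> 'a" where
  "entry n x k l = x $$ (pos n k, pos n l)"

text \<open>
  The induced class function of a function \<open>\<phi>\<close> on a subgroup H of a finite group G,
  given by the usual averaging formula with \<open>\<phi>\<close> extended by zero outside H.
\<close>

definition induced_char ::
    "('g, 'b) monoid_scheme \<Rightarrow> 'g set \<Rightarrow> ('g \<Rightarrow> complex) \<Rightarrow> 'g \<Rightarrow> complex" where
  "induced_char G H \<phi> g =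
     (\<Sum>x\<in>carrier G.
        let h = x \<otimes>\<^bsub>G\<^esub> g \<otimes>\<^bsub>G\<^esub> inv\<^bsub>G\<^esub> x in if h \<in> H then \<phi> h else 0)
     / of_nat (card H)"

definition entry_char ::
    "('a::field \<Rightarrow> complex) \<Rightarrow> nat \<Rightarrow> int \<Rightarrow> 'a \<Rightarrow> 'a mat \<Rightarrow> complex" where
  "entry_char \<theta> n i r x = \<theta> (r * entry n x i (- i))"

text \<open>
  The root \<open>2\<epsilon>\<^sub>i\<close> is represented by its index i, with \<open>1 \<le> i \<le> n\<close>.
\<close>

definition U_long :: "nat \<Rightarrow> int \<Rightarrow> 'a::field mat set" where
  "U_long n i = {x \<in> sylow_Sp n. \<forall>k. i < k \<and> k \<le> int n \<longrightarrow> entry n x i k = 0}"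

definition \<xi>_long ::
    "('a::field \<Rightarrow> complex) \<Rightarrow> nat \<Rightarrow> int \<Rightarrow> 'a \<Rightarrow> 'a mat \<Rightarrow> complex" where
  "\<xi>_long \<theta> n i r = induced_char (sylow_Sp_group n) (U_long n i) (entry_char \<theta> n i r)"

definition \<zeta>_sub :: "nat \<Rightarrow> int \<Rightarrow> 'a::field mat set" where
  "\<zeta>_sub n i =
     {x \<in> unitriangular (2 * n).
        \<forall>k\<in>signed_indices n. prec n i k \<and> prec n k (- i) \<longrightarrow> entry n x i k = 0}"

definition \<zeta>_super ::
    "('a::field \<Rightarrow> complex) \<Rightarrow> nat \<Rightarrow> int \<Rightarrow> 'a \<Rightarrow> 'a mat \<Rightarrow> complex" where
  "\<zeta>_super \<theta> n i r =
     induced_char (unitriangular_group (2 * n)) (\<zeta>_sub n i) (entry_char \<theta> n i r)"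

definition nonzero_squares :: "'a::field set" where
  "nonzero_squares = {t\<^sup>2 |t. t \<noteq> 0}"

lemma antidiag_carrier [simp]: "antidiag n \<in> carrier_mat n n"
  by (simp add: antidiag_def)

lemma antidiag_transpose [simp]: "transpose_mat (antidiag n) = antidiag n"
  by (rule eq_matI) (auto simp: antidiag_def)

lemma antidiag_square [simp]: "antidiag n * antidiag n = 1\<^sub>m n"
proof (rule eq_matI)
  fix a b assume "a < dim_row (1\<^sub>m n :: 'a mat)" "b < dim_col (1\<^sub>m n :: 'a mat)"
  then have ab: "a < n" "b < n" by auto
  have "(antidiag n * antidiag n :: 'a mat) $$ (a, b) =
      (\<Sum>c<n. (if a + c + 1 = n then 1 else 0) * (if c + b + 1 = n then 1 else 0))"
    using ab by (simp add: antidiag_def scalar_prod_def atLeast0LessThan)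
  also have "\<dots> = (\<Sum>c<n. if c = n - 1 - a then (if c + b + 1 = n then 1 else 0) else 0)"
    using ab by (intro sum.cong) auto
  also have "\<dots> = (if a = b then 1 else 0)"
    using ab by (subst sum.delta) auto
  finally show "(antidiag n * antidiag n :: 'a mat) $$ (a, b) = 1\<^sub>m n $$ (a, b)"
    using ab by simp
qed (auto simp: antidiag_def)

lemma unitriangularD:
  assumes "x \<in> unitriangular k"
  shows "x \<in> carrier_mat k k"
    and "\<And>a b. b < a \<Longrightarrow> a < k \<Longrightarrow> x $$ (a, b) = 0"
    and "\<And>a. a < k \<Longrightarrow> x $$ (a, a) = 1"
  using assms by (auto simp: unitriangular_def)

lemma unitriangular_det:
  assumes "x \<in> unitriangular k"
  shows "det x = 1"
proof -
  have "det x = prod_list (diag_mat x)"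
    using assms by (intro det_upper_triangular[of _ k]) (auto simp: unitriangular_def)
  also have "diag_mat x = map (\<lambda>_. 1) [0..<k]"
    using unitriangularD[OF assms] by (auto simp: diag_mat_def)
  also have "prod_list \<dots> = 1"
    by (induction k) auto
  finally show ?thesis .
qed

lemma unitriangular_right_inverse:
  assumes x: "x \<in> unitriangular k" and y: "y \<in> carrier_mat k k" and xy: "x * y = 1\<^sub>m k"
  shows "y \<in> unitriangular k"
proof -
  note xD = unitriangularD[OF x]
  have *: "y $$ (a, b) = (if a = b then 1 else 0)" if "b \<le> a" "a < k" for a b
    using that
  proof (induction "k - a" arbitrary: a rule: less_induct)
    case less
    have "(if a = b then 1 else 0) = (x * y) $$ (a, b)"
      using less.prems by (simp add: xy)
    also have "\<dots> = (\<Sum>c<k. x $$ (a, c) * y $$ (c, b))"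
      using less.prems xD(1) y by (auto simp: scalar_prod_def atLeast0LessThan)
    also have "\<dots> = (\<Sum>c<k. if c = a then y $$ (a, b) else 0)"
    proof (rule sum.cong)
      fix c assume "c \<in> {..<k}"
      then have c: "c < k" by simp
      consider "c < a" | "c = a" | "c > a" by linarith
      then show "x $$ (a, c) * y $$ (c, b) = (if c = a then y $$ (a, b) else 0)"
      proof cases
        case 3
        then have "y $$ (c, b) = 0"
          using less.hyps[of c] less.prems c by simp
        then show ?thesis using 3 by simp
      qed (use less.prems xD(2)[of c a] xD(3)[of a] in auto)
    qed simp
    also have "\<dots> = y $$ (a, b)"
      using less.prems by simp
    finally show ?case by simp
  qed
  show ?thesis
    using y * by (auto simp: unitriangular_def)
qed

lemma unitriangular_mult:
  assumes x: "x \<in> unitriangular k" and y: "y \<in> unitriangular k"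
  shows "x * y \<in> unitriangular k"
proof -
  note xD = unitriangularD[OF x] and yD = unitriangularD[OF y]
  have *: "(x * y) $$ (a, b) = (if a = b then 1 else 0)" if "b \<le> a" "a < k" for a b
  proof -
    have "(x * y) $$ (a, b) = (\<Sum>c<k. x $$ (a, c) * y $$ (c, b))"
      using that xD(1) yD(1) by (auto simp: scalar_prod_def atLeast0LessThan)
    also have "\<dots> = (\<Sum>c<k. if c = a then if a = b then 1 else 0 else 0)"
    proof (rule sum.cong)
      fix c assume "c \<in> {..<k}"
      then have c: "c < k" by simp
      consider "c < a" | "c = a" | "c > a" by linarith
      then show "x $$ (a, c) * y $$ (c, b) = (if c = a then if a = b then 1 else 0 else 0)"
        by cases (use that c xD(2)[of c a] xD(3)[of a] yD(2)[of b c] yD(3)[of b] in auto)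
    qed simp
    also have "\<dots> = (if a = b then 1 else 0)"
      using that by simp
    finally show ?thesis .
  qed
  show ?thesis
    using xD(1) yD(1) * by (auto simp: unitriangular_def)
qed

lemma unitriangular_one: "1\<^sub>m k \<in> unitriangular k"
  by (auto simp: unitriangular_def)

lemma group_GL: "group (GL k :: 'a::field mat monoid)"
proof -
  interpret R: ring "ring_mat TYPE('a) k ()" by (rule ring_mat)
  show ?thesis unfolding GL_def by (rule R.units_group)
qed

lemma GL_simps:
  "mult (GL k) = (*)" "one (GL k) = 1\<^sub>m k"
  "carrier (GL k :: 'a::field mat monoid) = Units (ring_mat TYPE('a) k ())"
  by (simp_all add: GL_def units_of_def ring_mat_simps)

lemma unitriangular_subset_GL:
  "unitriangular k \<subseteq> (carrier (GL k) :: 'a::field mat set)"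
proof
  fix x :: "'a mat" assume x: "x \<in> unitriangular k"
  show "x \<in> carrier (GL k)"
    unfolding GL_simps
    by (rule det_non_zero_imp_unit) (simp_all add: unitriangularD(1)[OF x] unitriangular_det[OF x])
qed

lemma symp_form_carrier [simp]: "symp_form n \<in> carrier_mat (2 * n) (2 * n)"
  unfolding symp_form_def mult_2 by (rule four_block_carrier_mat) simp_all

lemma Sp_mult:
  assumes x: "x \<in> Sp n" and y: "y \<in> Sp n"
  shows "x * y \<in> Sp n"
proof -
  let ?m = "2 * n" and ?F = "symp_form n"
  have c: "x \<in> carrier_mat ?m ?m" "y \<in> carrier_mat ?m ?m"
    and e: "transpose_mat x * ?F * x = ?F" "transpose_mat y * ?F * y = ?F"
    using x y by (auto simp: Sp_def)
  have "transpose_mat (x * y) * ?F * (x * y) = transpose_mat y * (transpose_mat x * ?F * x) * y"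
    using c by (simp add: transpose_mult[of _ ?m ?m _ ?m] assoc_mult_mat[of _ ?m ?m _ ?m _ ?m]
      mult_carrier_mat[of _ ?m ?m _ ?m])
  then show ?thesis
    using c e by (simp add: Sp_def)
qed

lemma Sp_right_inverse:
  assumes x: "x \<in> Sp n" and y: "y \<in> carrier_mat (2 * n) (2 * n)" and xy: "x * y = 1\<^sub>m (2 * n)"
  shows "y \<in> Sp n"
proof -
  let ?m = "2 * n" and ?F = "symp_form n"
  have c: "x \<in> carrier_mat ?m ?m" and e: "transpose_mat x * ?F * x = ?F"
    using x by (auto simp: Sp_def)
  have "transpose_mat y * ?F * y = transpose_mat y * (transpose_mat x * ?F * x) * y"
    by (simp add: e)
  also have "\<dots> = transpose_mat (x * y) * ?F * (x * y)"
    using c y by (simp add: transpose_mult[of _ ?m ?m _ ?m] assoc_mult_mat[of _ ?m ?m _ ?m _ ?m]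
      mult_carrier_mat[of _ ?m ?m _ ?m])
  finally show ?thesis
    using y by (simp add: Sp_def xy left_mult_one_mat[of _ ?m ?m] right_mult_one_mat[of _ ?m ?m])
qed

lemma Sp_one: "1\<^sub>m (2 * n) \<in> Sp n"
  by (simp add: Sp_def left_mult_one_mat[of _ "2 * n" "2 * n"] right_mult_one_mat[of _ "2 * n" "2 * n"])

lemma GL_right_inverse:
  fixes x :: "'a::field mat"
  assumes "x \<in> carrier (GL k)"
  shows "inv\<^bsub>GL k\<^esub> x \<in> carrier_mat k k" "x * inv\<^bsub>GL k\<^esub> x = 1\<^sub>m k"
proof -
  have "inv\<^bsub>GL k\<^esub> x \<in> Units (ring_mat TYPE('a) k ())"
    using group.inv_closed[OF group_GL assms] unfolding GL_simps .
  then show "inv\<^bsub>GL k\<^esub> x \<in> carrier_mat k k"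
    unfolding Units_def ring_mat_simps by blast
  show "x * inv\<^bsub>GL k\<^esub> x = 1\<^sub>m k"
    using group.r_inv[OF group_GL assms] unfolding GL_simps .
qed

lemma subgroup_unitriangular: "subgroup (unitriangular k) (GL k)"
proof (rule subgroup.intro)
  fix x :: "'a mat" assume x: "x \<in> unitriangular k"
  then have "x \<in> carrier (GL k)"
    using unitriangular_subset_GL by auto
  from GL_right_inverse[OF this] show "inv\<^bsub>GL k\<^esub> x \<in> unitriangular k"
    using x unitriangular_right_inverse by blast
next
  show "(unitriangular k :: 'a mat set) \<subseteq> carrier (GL k)"
    by (rule unitriangular_subset_GL)
next
  fix x y :: "'a mat" assume "x \<in> unitriangular k" "y \<in> unitriangular k"
  then show "x \<otimes>\<^bsub>GL k\<^esub> y \<in> unitriangular k"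
    unfolding GL_simps(1) by (rule unitriangular_mult)
next
  show "\<one>\<^bsub>GL k\<^esub> \<in> (unitriangular k :: 'a mat set)"
    unfolding GL_simps(2) by (rule unitriangular_one)
qed

lemma subgroup_sylow_Sp: "subgroup (sylow_Sp n) (GL (2 * n))"
proof (rule subgroup.intro)
  fix x :: "'a mat" assume x: "x \<in> sylow_Sp n"
  then have "x \<in> carrier (GL (2 * n))"
    using unitriangular_subset_GL by (auto simp: sylow_Sp_def)
  from GL_right_inverse[OF this] show "inv\<^bsub>GL (2 * n)\<^esub> x \<in> sylow_Sp n"
    using x Sp_right_inverse unitriangular_right_inverse unfolding sylow_Sp_def by blast
next
  show "(sylow_Sp n :: 'a mat set) \<subseteq> carrier (GL (2 * n))"
    unfolding sylow_Sp_def using unitriangular_subset_GL by (rule le_infI2)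
next
  fix x y :: "'a mat" assume "x \<in> sylow_Sp n" "y \<in> sylow_Sp n"
  then show "x \<otimes>\<^bsub>GL (2 * n)\<^esub> y \<in> sylow_Sp n"
    unfolding GL_simps(1) sylow_Sp_def by (blast intro: Sp_mult unitriangular_mult)
next
  show "\<one>\<^bsub>GL (2 * n)\<^esub> \<in> (sylow_Sp n :: 'a mat set)"
    unfolding GL_simps(2) sylow_Sp_def by (intro IntI Sp_one unitriangular_one)
qed

lemma mat_mult_entry:
  assumes "A \<in> carrier_mat n n" "B \<in> carrier_mat n n" "a < n" "b < n"
  shows "(A * B) $$ (a, b) = (\<Sum>c<n. A $$ (a, c) * B $$ (c, b))"
  using assms by (auto simp: scalar_prod_def atLeast0LessThan)

lemma antidiag_conj_entry:
  assumes A: "A \<in> carrier_mat n n" and "a < n" "b < n"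
  shows "(antidiag n * A * antidiag n) $$ (a, b) = A $$ (n - 1 - a, n - 1 - b)"
proof -
  have J: "(antidiag n * A) $$ (a, c) = A $$ (n - 1 - a, c)" if "c < n" for c
  proof -
    have "(antidiag n * A) $$ (a, c) = (\<Sum>d<n. antidiag n $$ (a, d) * A $$ (d, c))"
      using assms that by (intro mat_mult_entry) auto
    also have "\<dots> = (\<Sum>d<n. if d = n - 1 - a then A $$ (d, c) else 0)"
      using assms by (intro sum.cong) (auto simp: antidiag_def)
    finally show ?thesis using assms by simp
  qed
  have "(antidiag n * A * antidiag n) $$ (a, b) =
      (\<Sum>c<n. (antidiag n * A) $$ (a, c) * antidiag n $$ (c, b))"
    using assms by (intro mat_mult_entry mult_carrier_mat[of _ n n]) auto
  also have "\<dots> = (\<Sum>c<n. if c = n - 1 - b then A $$ (n - 1 - a, c) else 0)"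
    using assms J by (intro sum.cong) (auto simp: antidiag_def simp del: index_mult_mat)
  finally show ?thesis using assms by simp
qed

lemma four_block_mat_eq_iff:
  assumes "A \<in> carrier_mat n n" "B \<in> carrier_mat n n" "C \<in> carrier_mat n n" "D \<in> carrier_mat n n"
    and "A' \<in> carrier_mat n n" "B' \<in> carrier_mat n n" "C' \<in> carrier_mat n n" "D' \<in> carrier_mat n n"
  shows "four_block_mat A B C D = four_block_mat A' B' C' D' \<longleftrightarrow>
    A = A' \<and> B = B' \<and> C = C' \<and> D = D'"
proof
  let ?M = "four_block_mat A B C D" and ?M' = "four_block_mat A' B' C' D'"
  assume eq: "?M = ?M'"
  have *: "?M $$ (a, b) = ?M' $$ (a, b)" for a b
    by (simp only: eq)
  have "A $$ (a, b) = A' $$ (a, b) \<and> B $$ (a, b) = B' $$ (a, b) \<and>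
      C $$ (a, b) = C' $$ (a, b) \<and> D $$ (a, b) = D' $$ (a, b)" if "a < n" "b < n" for a b
    using that assms *[of a b] *[of a "b + n"] *[of "a + n" b] *[of "a + n" "b + n"] by simp
  then show "A = A' \<and> B = B' \<and> C = C' \<and> D = D'"
    using assms by auto
qed simp

lemma symp_form_block_iff:
  fixes A B D :: "'a::field mat"
  assumes A: "A \<in> carrier_mat n n" and B: "B \<in> carrier_mat n n" and D: "D \<in> carrier_mat n n"
  defines "J \<equiv> antidiag n" and "M \<equiv> four_block_mat A B (0\<^sub>m n n) D"
  shows "transpose_mat M * symp_form n * M = symp_form n \<longleftrightarrow>
     transpose_mat A * J * D = J \<and> transpose_mat B * J * D = transpose_mat D * J * B"
proof -
  let ?Z = "0\<^sub>m n n :: 'a mat"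
  note mc = mult_carrier_mat[of _ n n _ n]
  have J: "J \<in> carrier_mat n n" and JT: "transpose_mat J = J"
    by (simp_all add: J_def)
  have F: "symp_form n = four_block_mat ?Z J (- J) ?Z"
    by (simp add: symp_form_def J_def)
  have MT: "transpose_mat M =
      four_block_mat (transpose_mat A) ?Z (transpose_mat B) (transpose_mat D)"
    using A B D by (simp add: M_def transpose_four_block_mat[of _ n n _ n _ n])
  have "transpose_mat M * symp_form n =
      four_block_mat ?Z (transpose_mat A * J) (- (transpose_mat D * J)) (transpose_mat B * J)"
    unfolding MT F using A B D J
    by (subst mult_four_block_mat[of _ n n _ n _ n _ _ n _ n])
      (auto simp: mc right_add_zero_mat[of _ n n] left_add_zero_mat[of _ n n])
  then have M: "transpose_mat M * symp_form n * M =
      four_block_mat ?Z (transpose_mat A * J * D) (- (transpose_mat D * J * A))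
        (- (transpose_mat D * J * B) + transpose_mat B * J * D)"
    using A B D J
    by (simp add: M_def, subst mult_four_block_mat[of _ n n _ n _ n _ _ n _ n])
      (auto simp: mc right_add_zero_mat[of _ n n] left_add_zero_mat[of _ n n]
        right_mult_zero_mat[of _ n n])
  have 1: "transpose_mat D * J * A = J" if "transpose_mat A * J * D = J"
  proof -
    have "transpose_mat D * J * A = transpose_mat (transpose_mat A * J * D)"
      using A D J JT
      by (simp add: transpose_mult[of _ n n _ n] assoc_mult_mat[of _ n n _ n _ n] mc)
    then show ?thesis by (simp add: that JT)
  qed
  have 2: "- P + Q = ?Z \<longleftrightarrow> Q = P" if P: "P \<in> carrier_mat n n" and Q: "Q \<in> carrier_mat n n"
    for P Q :: "'a mat"
  proof
    assume eq: "- P + Q = ?Z"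
    have "Q = P + (- P + Q)"
      using P Q by (intro eq_matI) auto
    then show "Q = P" using P by (simp add: eq)
  qed (use P in simp)
  show ?thesis
    unfolding M unfolding F using A B D J 1
    by (subst four_block_mat_eq_iff[of _ n]) (auto simp: mc 2)
qed

lemma sylow_Sp_block_form:
  fixes n :: nat
  defines "J \<equiv> antidiag n"
  shows "(sylow_Sp n :: 'a::field mat set) =
    {four_block_mat x (x * z) (0\<^sub>m n n) (J * transpose_mat x' * J) |x x' z.
       x \<in> unitriangular n \<and> x' \<in> carrier_mat n n \<and> x * x' = 1\<^sub>m n \<and>
       z \<in> carrier_mat n n \<and> J * transpose_mat z - z * J = 0\<^sub>m n n}" (is "_ = ?R")
proof -
  note mc = mult_carrier_mat[of _ n n _ n]
  note assoc = assoc_mult_mat[of _ n n _ n _ n]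
  have J: "J \<in> carrier_mat n n" and JT: "transpose_mat J = J" and JJ: "J * J = 1\<^sub>m n"
    by (simp_all add: J_def)
  have JJ': "J * (J * A) = A" if "A \<in> carrier_mat n n" for A
  proof -
    have "J * (J * A) = J * J * A" using that J by (simp add: assoc)
    then show ?thesis using that by (simp add: JJ)
  qed
  have minus: "P - Q = 0\<^sub>m n n \<longleftrightarrow> P = Q" if P: "P \<in> carrier_mat n n" and Q: "Q \<in> carrier_mat n n"
    for P Q :: "'a mat"
  proof
    assume eq: "P - Q = 0\<^sub>m n n"
    have "P = (P - Q) + Q"
      using P Q by (intro eq_matI) auto
    then show "P = Q" using Q by (simp add: eq)
  qed (use P in simp)
  have block: "four_block_mat x (x * z) (0\<^sub>m n n) D \<in> sylow_Sp n \<longleftrightarrow>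
      x \<in> unitriangular n \<and> D = J * transpose_mat x' * J \<and> J * transpose_mat z - z * J = 0\<^sub>m n n"
    if x: "x \<in> unitriangular n" and x': "x' \<in> carrier_mat n n" and xx': "x * x' = 1\<^sub>m n"
      and z: "z \<in> carrier_mat n n" and D: "D \<in> carrier_mat n n"
    for x x' z D :: "'a mat"
  proof -
    have xc: "x \<in> carrier_mat n n" using x by (rule unitriangularD)
    have x'x: "x' * x = 1\<^sub>m n"
      by (rule mat_mult_left_right_inverse[OF xc x' xx'])
    have tx: "transpose_mat x' * transpose_mat x = 1\<^sub>m n"
      using transpose_mult[OF xc x'] by (simp add: xx')
    have tx': "transpose_mat x * transpose_mat x' = 1\<^sub>m n"
      using transpose_mult[OF x' xc] by (simp add: x'x)
    have txA: "transpose_mat x' * (transpose_mat x * A) = A"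
      "transpose_mat x * (transpose_mat x' * A) = A" "x' * (x * A) = A" if "A \<in> carrier_mat n n" for A
      using that xc x' assoc[of "transpose_mat x'" "transpose_mat x" A]
        assoc[of "transpose_mat x" "transpose_mat x'" A] assoc[of x' x A]
      by (simp_all add: tx tx' x'x)
    have D_iff: "transpose_mat x * J * D = J \<longleftrightarrow> D = J * transpose_mat x' * J"
    proof
      assume "transpose_mat x * J * D = J"
      then have "J * (transpose_mat x' * (transpose_mat x * J * D)) = J * (transpose_mat x' * J)"
        by simp
      then show "D = J * transpose_mat x' * J"
        using xc x' J D by (simp add: assoc mc txA JJ')
    next
      assume "D = J * transpose_mat x' * J"
      then show "transpose_mat x * J * D = J"
        using xc x' J by (simp add: assoc mc txA JJ')
    qed
    have z_iff: "transpose_mat (x * z) * J * D = transpose_mat D * J * (x * z) \<longleftrightarrow>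
        J * transpose_mat z - z * J = 0\<^sub>m n n" if DD: "D = J * transpose_mat x' * J"
    proof -
      have "transpose_mat (x * z) * J * D = transpose_mat z * J"
        unfolding DD using xc x' J z by (simp add: assoc mc txA JJ' transpose_mult[of _ n n _ n])
      moreover have "transpose_mat D * J * (x * z) = J * z"
        unfolding DD using xc x' J z
        by (simp add: assoc mc txA JJ' transpose_mult[of _ n n _ n] JT)
      moreover have "transpose_mat z * J = J * z \<longleftrightarrow> J * transpose_mat z = z * J"
      proof
        assume "transpose_mat z * J = J * z"
        then have "J * (transpose_mat z * J * J) = J * (J * z * J)" by simp
        then show "J * transpose_mat z = z * J"
          using J z by (simp add: assoc mc JJ JJ')
      next
        assume "J * transpose_mat z = z * J"
        then have "J * (J * transpose_mat z * J) = J * (z * J * J)" by simp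
        then show "transpose_mat z * J = J * z"
          using J z by (simp add: assoc mc JJ JJ')
      qed
      ultimately show ?thesis using J z by (simp add: minus mc)
    qed
    have "four_block_mat x (x * z) (0\<^sub>m n n) D \<in> unitriangular (2 * n)"
      if DD: "D = J * transpose_mat x' * J"
    proof -
      have x'u: "x' \<in> unitriangular n"
        by (rule unitriangular_right_inverse[OF x x' xx'])
      have De: "D $$ (a, b) = x' $$ (n - 1 - b, n - 1 - a)" if "a < n" "b < n" for a b
        using that x' antidiag_conj_entry[of "transpose_mat x'" n a b] by (simp add: DD J_def)
      have "D \<in> unitriangular n"
        using D De unitriangularD[OF x'u] by (auto simp: unitriangular_def)
      then show ?thesis
        using xc x z by (auto simp: unitriangular_def mult_2 intro!: upper_triangular_four_block[of _ n _ n])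
    qed
    moreover have "four_block_mat x (x * z) (0\<^sub>m n n) D \<in> carrier_mat (2 * n) (2 * n)"
      using xc D unfolding mult_2 by (rule four_block_carrier_mat)
    ultimately show ?thesis
      using symp_form_block_iff[of x n "x * z" D] xc z D D_iff z_iff x
      by (auto simp: sylow_Sp_def Sp_def J_def mc)
  qed
  show ?thesis
  proof (intro subset_antisym subsetI)
    fix M :: "'a mat" assume M: "M \<in> sylow_Sp n"
    obtain x B C D where s: "split_block M n n = (x, B, C, D)"
      by (metis prod_cases4)
    have Mc: "dim_row M = n + n" "dim_col M = n + n" and Mu: "M \<in> unitriangular (n + n)"
      using M by (auto simp: sylow_Sp_def Sp_def mult_2)
    note sb = split_block[OF s Mc]
    have Me: "M $$ (a, b) = (if a < n then if b < n then x $$ (a, b) else B $$ (a, b - n)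
         else if b < n then C $$ (a - n, b) else D $$ (a - n, b - n))" if "a < n + n" "b < n + n" for a b
      using that sb by simp
    note MD = unitriangularD[OF Mu]
    have C: "C = 0\<^sub>m n n"
    proof (rule eq_matI)
      fix a b assume "a < dim_row (0\<^sub>m n n :: 'a mat)" "b < dim_col (0\<^sub>m n n :: 'a mat)"
      then show "C $$ (a, b) = 0\<^sub>m n n $$ (a, b)"
        using Me[of "a + n" b] MD(2)[of b "a + n"] by simp
    qed (use sb in auto)
    have x: "x \<in> unitriangular n"
      unfolding unitriangular_def
    proof (intro CollectI conjI upper_triangularI allI impI)
      show "x \<in> carrier_mat n n" by (rule sb)
    next
      fix a b assume "b < a" "a < dim_row x"
      then show "x $$ (a, b) = 0" using sb Me[of a b] MD(2)[of b a] by simp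
    next
      fix a assume "a < n"
      then show "x $$ (a, a) = 1" using Me[of a a] MD(3)[of a] by simp
    qed
    then have "x \<in> carrier (GL n)"
      using unitriangular_subset_GL by auto
    from GL_right_inverse[OF this] obtain x' where
      x': "x' \<in> carrier_mat n n" and xx': "x * x' = 1\<^sub>m n" by blast
    define z where "z = x' * B"
    have z: "z \<in> carrier_mat n n"
      using x' sb by (simp add: z_def mc)
    have "x * z = x * x' * B"
      using sb x' by (simp add: z_def assoc)
    then have B: "x * z = B"
      using sb by (simp add: xx')
    have Meq: "M = four_block_mat x (x * z) (0\<^sub>m n n) D"
      unfolding B C[symmetric] by (rule sb)
    show "M \<in> ?R"
      using block[OF x x' xx' z sb(4)] M x x' xx' z Meq by auto
  next
    fix M :: "'a mat" assume "M \<in> ?R"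
    then obtain x x' z where "x \<in> unitriangular n" "x' \<in> carrier_mat n n" "x * x' = 1\<^sub>m n"
      "z \<in> carrier_mat n n" "J * transpose_mat z - z * J = 0\<^sub>m n n"
      and M: "M = four_block_mat x (x * z) (0\<^sub>m n n) (J * transpose_mat x' * J)"
      by blast
    then show "M \<in> sylow_Sp n"
      using block[of x x' z "J * transpose_mat x' * J"] J by (simp add: M mc)
  qed
qed

end

theory Submission
  imports Defs "HOL-Number_Theory.Residues"
begin

text \<open>
  Write \<open>x = (A, Az; 0, J A\<^sup>-\<^sup>T J)\<close> and put \<open>Y = zJ\<close>, a symmetric matrix, and \<open>Q u = u Y u\<^sup>T\<close>.  Summing over
  cosets according to row i, the value \<open>\<xi>\<^bsub>2\<epsilon>\<^sub>i,r\<^esub>(x)\<close> becomes the sum of \<open>\<theta>(r Q u)\<close> over the row vectors u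
  fixed by A whose first nonzero entry is a 1 in place i.  In \<open>\<zeta>(x)\<close> the same sum appears, weighted by
  the number of solutions w of a linear system with right-hand side \<open>Y u\<^sup>T\<close>; by orthogonality of
  characters this number is the sum of \<open>\<theta>(t Y u\<^sup>T)\<close> over the space K of vectors t fixed by A and supported
  in places beyond i.  Completing the square turns the weight into the constant \<open>\<Sum>\<^bsub>t\<in>K\<^esub> \<theta>(-r\<^sup>-\<^sup>1 Q t)\<close>, and
  writing the nonzero t as \<open>c u\<close>, where u has leading entry 1 in place \<open>j > i\<close>, gives the
  characters \<open>\<xi>\<^bsub>2\<epsilon>\<^sub>j,s\<^esub>\<close> with \<open>s = -r\<^sup>-\<^sup>1 c\<^sup>2\<close>; each s arises from two values of c.
\<close>

section \<open>Row vectors: fixed spaces, leading and tail vectors\<close>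

text \<open>Row vectors are stored as ordinary vectors, so \<open>u A = u\<close> appears as an
  equation with the transpose of \<open>A\<close>.\<close>

definition fixed_rows :: "'a::field mat \<Rightarrow> 'a vec set" where
  "fixed_rows A = {u \<in> carrier_vec (dim_row A). transpose_mat A *\<^sub>v u = u}"

text \<open>For \<open>i < n\<close> these are exactly the possible rows in place \<open>i\<close>
  of a unitriangular matrix.\<close>

definition lead_vecs :: "nat \<Rightarrow> nat \<Rightarrow> 'a::field vec set" where
  "lead_vecs n i = {u \<in> carrier_vec n. (\<forall>k<i. u $ k = 0) \<and> u $ i = 1}"

text \<open>For \<open>i < n\<close> this is the space of differences of elements of
  \<open>lead_vecs n i\<close>. The guard \<open>k < n\<close> keeps unspecified entries out when
  \<open>i \<ge> n\<close>.\<close>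

definition tail_vecs :: "nat \<Rightarrow> nat \<Rightarrow> 'a::field vec set" where
  "tail_vecs n i = {w \<in> carrier_vec n. \<forall>k\<le>i. k < n \<longrightarrow> w $ k = 0}"

lemma finite_carrier_vec: "finite (carrier_vec n :: 'a::finite vec set)"
proof (rule finite_subset)
  show "carrier_vec n \<subseteq> vec n ` ({..<n} \<rightarrow>\<^sub>E (UNIV :: 'a set))"
  proof
    fix v :: "'a vec" assume "v \<in> carrier_vec n"
    then have "v = vec n (restrict (vec_index v) {..<n})" by (intro eq_vecI) simp_all
    then show "v \<in> vec n ` ({..<n} \<rightarrow>\<^sub>E (UNIV :: 'a set))"
      by (rule image_eqI[where f = "vec n"]) simp
  qed
qed (simp add: finite_PiE)

lemma finite_carrier_mat: "finite (carrier_mat n m :: 'a::finite mat set)"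
proof (rule finite_subset)
  show "carrier_mat n m \<subseteq> mat n m ` (({..<n} \<times> {..<m}) \<rightarrow>\<^sub>E (UNIV :: 'a set))"
  proof
    fix M :: "'a mat" assume "M \<in> carrier_mat n m"
    then have "M = mat n m (restrict (index_mat M) ({..<n} \<times> {..<m}))"
      by (intro eq_matI) simp_all
    then show "M \<in> mat n m ` (({..<n} \<times> {..<m}) \<rightarrow>\<^sub>E (UNIV :: 'a set))"
      by (rule image_eqI[where f = "mat n m"]) simp
  qed
qed (simp add: finite_PiE)

lemma finite_lead_vecs [simp]: "finite (lead_vecs n i :: 'a::{field,finite} vec set)"
  by (rule finite_subset[OF _ finite_carrier_vec]) (auto simp: lead_vecs_def)

lemma finite_tail_vecs [simp]: "finite (tail_vecs n i :: 'a::{field,finite} vec set)"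
  by (rule finite_subset[OF _ finite_carrier_vec]) (auto simp: tail_vecs_def)

lemma tail_vecs_closed:
  assumes "v \<in> tail_vecs n i" "w \<in> tail_vecs n i"
  shows "v + w \<in> tail_vecs n i" "v - w \<in> tail_vecs n i" "c \<cdot>\<^sub>v v \<in> tail_vecs n i"
  using assms by (auto simp: tail_vecs_def)

lemma unit_vec_in_tail_vecs: "i < k \<Longrightarrow> k < n \<Longrightarrow> unit_vec n k \<in> tail_vecs n i"
  by (auto simp: tail_vecs_def)

lemma zero_in_tail_vecs: "0\<^sub>v n \<in> tail_vecs n i"
  by (auto simp: tail_vecs_def)

section \<open>Induced characters as sums over coset invariants\<close>

text \<open>A condition of the form \<open>g x g\<inverse> \<in> H\<close> is stated as \<open>y \<in> H\<close> where \<open>y g = g x\<close>.\<close>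

lemma induced_char_fibres:
  assumes "group G" and fin: "finite (carrier G)" and H: "H \<subseteq> carrier G" and x: "x \<in> carrier G"
    and img: "\<pi> ` carrier G = P"
    and coset: "\<And>k g. k \<in> carrier G \<Longrightarrow> g \<in> carrier G \<Longrightarrow> \<pi> (k \<otimes>\<^bsub>G\<^esub> g) = \<pi> g \<longleftrightarrow> k \<in> H"
    and val: "\<And>g y. g \<in> carrier G \<Longrightarrow> y \<in> carrier G \<Longrightarrow> y \<otimes>\<^bsub>G\<^esub> g = g \<otimes>\<^bsub>G\<^esub> x \<Longrightarrow>
      (if y \<in> H then \<phi> y else 0) = F (\<pi> g)"
  shows "induced_char G H \<phi> x = (\<Sum>p\<in>P. F p)"
proof -
  interpret group G by fact
  have fibre: "card {g \<in> carrier G. \<pi> g = p} = card H" if p: "p \<in> P" for p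
  proof -
    obtain g0 where g0: "g0 \<in> carrier G" "\<pi> g0 = p"
      using p img by auto
    \<comment> \<open>The hypothesis \<open>coset\<close> says that the fibre of
      \<open>\<pi>\<close> through \<open>g0\<close> is the right coset \<open>H g0\<close>.\<close>
    have "bij_betw (\<lambda>h. h \<otimes>\<^bsub>G\<^esub> g0) H {g \<in> carrier G. \<pi> g = p}"
    proof (rule bij_betw_byWitness[where f' = "\<lambda>g. g \<otimes>\<^bsub>G\<^esub> inv\<^bsub>G\<^esub> g0"])
      show "\<forall>h\<in>H. h \<otimes>\<^bsub>G\<^esub> g0 \<otimes>\<^bsub>G\<^esub> inv\<^bsub>G\<^esub> g0 = h"
        using H g0 by (auto simp: m_assoc subset_iff)
      show *: "\<forall>g\<in>{g \<in> carrier G. \<pi> g = p}. g \<otimes>\<^bsub>G\<^esub> inv\<^bsub>G\<^esub> g0 \<otimes>\<^bsub>G\<^esub> g0 = g"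
        using g0 by (auto simp: m_assoc)
      show "(\<lambda>h. h \<otimes>\<^bsub>G\<^esub> g0) ` H \<subseteq> {g \<in> carrier G. \<pi> g = p}"
        using H g0 coset by (auto simp: subset_iff)
      show "(\<lambda>g. g \<otimes>\<^bsub>G\<^esub> inv\<^bsub>G\<^esub> g0) ` {g \<in> carrier G. \<pi> g = p} \<subseteq> H"
      proof clarify
        fix g assume g: "g \<in> carrier G" "p = \<pi> g"
        then show "g \<otimes>\<^bsub>G\<^esub> inv\<^bsub>G\<^esub> g0 \<in> H"
          using * g0 coset[of "g \<otimes>\<^bsub>G\<^esub> inv\<^bsub>G\<^esub> g0" g0] by auto
      qed
    qed
    then show ?thesis by (metis bij_betw_same_card)
  qed
  have "\<one>\<^bsub>G\<^esub> \<in> H"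
    \<comment> \<open>The hypothesis \<open>coset\<close> at the identity shows that
      \<open>H\<close> is nonempty, so that the division by \<open>card H\<close> is
      legitimate.\<close>
    using coset[of "\<one>\<^bsub>G\<^esub>" "\<one>\<^bsub>G\<^esub>"] by simp
  then have cH: "card H \<noteq> 0"
    using finite_subset[OF H fin] by auto
  have summand: "(let h = g \<otimes>\<^bsub>G\<^esub> x \<otimes>\<^bsub>G\<^esub> inv\<^bsub>G\<^esub> g in if h \<in> H then \<phi> h else 0) = F (\<pi> g)"
    if g: "g \<in> carrier G" for g
    unfolding Let_def using g x by (intro val) (simp_all add: m_assoc)
  have "(\<Sum>g\<in>carrier G. F (\<pi> g)) = (\<Sum>p\<in>\<pi> ` carrier G. \<Sum>g\<in>{g \<in> carrier G. \<pi> g = p}. F (\<pi> g))"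
    by (rule sum.image_gen[OF fin])
  also have "\<dots> = of_nat (card H) * (\<Sum>p\<in>P. F p)"
    unfolding img sum_distrib_left using fibre by (intro sum.cong) auto
  finally show ?thesis
    using cH summand by (simp add: induced_char_def cong: sum.cong)
qed

section \<open>Additive characters and orthogonality\<close>

text \<open>The values lie in all of the complex numbers, so \<open>nonzero\<close> is what excludes
  the zero function, which satisfies the other two conditions.\<close>

locale add_char =
  fixes \<theta> :: "'a::{field,finite} \<Rightarrow> complex"
  assumes add: "\<theta> (a + b) = \<theta> a * \<theta> b"
    and nonzero: "\<theta> a \<noteq> 0"
    and nontrivial: "\<exists>a. \<theta> a \<noteq> 1"
begin

lemma zero [simp]: "\<theta> 0 = 1"
  using add[of 0 0] nonzero[of 0] by simp

text \<open>Orthogonality: \<open>w \<mapsto> \<theta> (w \<bullet> c)\<close> is a character of the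
  additive group of tail vectors, trivial exactly when \<open>c\<close> vanishes beyond
  \<open>i\<close>.\<close>

lemma sum_tail_vecs:
  assumes c: "c \<in> carrier_vec n"
  shows "(\<Sum>w\<in>tail_vecs n i. \<theta> (w \<bullet> c)) =
    (if \<forall>k. i < k \<and> k < n \<longrightarrow> c $ k = 0 then of_nat (card (tail_vecs n i :: 'a vec set)) else 0)"
proof (cases "\<forall>k. i < k \<and> k < n \<longrightarrow> c $ k = 0")
  case True
  have "w \<bullet> c = 0" if "w \<in> tail_vecs n i" for w
    unfolding scalar_prod_def
  proof (rule sum.neutral, clarify)
    fix k assume "k \<in> {0..<dim_vec c}"
    then show "w $ k * c $ k = 0"
      using that True c by (cases "k \<le> i") (auto simp: tail_vecs_def)
  qed
  then show ?thesis using True by simp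
next
  case False
  then obtain k where k: "i < k" "k < n" "c $ k \<noteq> 0" by auto
  obtain a where a: "\<theta> a \<noteq> 1" using nontrivial by auto
  \<comment> \<open>Scaled so that \<open>w0 \<bullet> c = a\<close>: translation by
    \<open>w0\<close> permutes the tail vectors and multiplies the sum by
    \<open>\<theta> a \<noteq> 1\<close>.\<close>
  define w0 where "w0 = (a / c $ k) \<cdot>\<^sub>v unit_vec n k"
  have w0: "w0 \<in> tail_vecs n i" "w0 \<bullet> c = a"
    using k c by (auto simp: w0_def intro: tail_vecs_closed unit_vec_in_tail_vecs)
  let ?S = "\<Sum>w\<in>tail_vecs n i. \<theta> (w \<bullet> c)"
  have "w - w0 + w0 = w" "w + w0 - w0 = w" if "w \<in> tail_vecs n i" for w
    using that w0 by (auto simp: tail_vecs_def)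
  then have "?S = (\<Sum>w\<in>tail_vecs n i. \<theta> ((w + w0) \<bullet> c))"
    by (intro sum.reindex_bij_witness[where j = "\<lambda>w. w - w0" and i = "\<lambda>w. w + w0"])
      (use w0 in \<open>auto intro!: tail_vecs_closed\<close>)
  also have "\<dots> = (\<Sum>w\<in>tail_vecs n i. \<theta> (w \<bullet> c) * \<theta> a)"
    using w0 c by (intro sum.cong refl)
      (auto simp: tail_vecs_def add add_scalar_prod_distrib[of _ n])
  also have "\<dots> = ?S * \<theta> a"
    by (rule sum_distrib_right[symmetric])
  finally have "?S = ?S * \<theta> a" .
  then have "?S = 0" using a by simp
  then show ?thesis unfolding if_not_P[OF False] .
qed

end

section \<open>Unitriangular matrices acting on row vectors\<close>

text \<open>Place \<open>i\<close> is the only one where both vectors can be nonzero. This recovers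
  an entry of \<open>c\<close> from a scalar product.\<close>

lemma lead_scalar_prod:
  assumes u: "u \<in> lead_vecs n i" and c: "c \<in> carrier_vec n" and i: "i < n"
    and z: "\<And>k. i < k \<Longrightarrow> k < n \<Longrightarrow> c $ k = 0"
  shows "u \<bullet> c = c $ i"
proof -
  have "u \<bullet> c = (\<Sum>k\<in>{0..<n}. if k = i then c $ i else 0)"
    unfolding scalar_prod_def
  proof (rule sum.cong)
    fix k assume "k \<in> {0..<n}"
    then show "u $ k * c $ k = (if k = i then c $ i else 0)"
      using u z[of k] by (cases k i rule: linorder_cases) (auto simp: lead_vecs_def)
  qed (use c in auto)
  then show ?thesis using i by simp
qed

lemma unitriangular_transpose_inverse:
  assumes A: "A \<in> unitriangular n" and A': "A' \<in> unitriangular n" and inv: "A * A' = 1\<^sub>m n"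
    and u: "u \<in> carrier_vec n" and v: "v \<in> carrier_vec n"
  shows "transpose_mat A *\<^sub>v u = v \<longleftrightarrow> u = transpose_mat A' *\<^sub>v v"
proof -
  note c = unitriangularD(1)[OF A] unitriangularD(1)[OF A']
  have 1: "transpose_mat A' * transpose_mat A = 1\<^sub>m n"
    using transpose_mult[OF c] inv by simp
  have 2: "transpose_mat A * transpose_mat A' = 1\<^sub>m n"
    using c 1 by (intro mat_mult_left_right_inverse[OF _ _ 1]) auto
  have 3: "transpose_mat A' *\<^sub>v (transpose_mat A *\<^sub>v u) = u"
    using c u 1 by (subst assoc_mult_mat_vec[symmetric, of _ n n _ n]) auto
  have 4: "transpose_mat A *\<^sub>v (transpose_mat A' *\<^sub>v v) = v"
    using c v 2 by (subst assoc_mult_mat_vec[symmetric, of _ n n _ n]) auto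
  from 3 4 show ?thesis by auto
qed

lemma transpose_mult_vec_entry:
  assumes "A \<in> carrier_mat n n" "u \<in> carrier_vec n" "k < n"
  shows "(transpose_mat A *\<^sub>v u) $ k = (\<Sum>l<n. A $$ (l, k) * u $ l)"
  using assms by (auto simp: scalar_prod_def atLeast0LessThan)

text \<open>Multiplying rows by an upper triangular matrix preserves the flag of tail
  spaces.\<close>

lemma transpose_unitriangular_tail:
  assumes A: "A \<in> unitriangular n" and t: "t \<in> tail_vecs n i" and k: "k \<le> i" "k < n"
  shows "(transpose_mat A *\<^sub>v t) $ k = 0"
proof -
  have "(transpose_mat A *\<^sub>v t) $ k = (\<Sum>l<n. A $$ (l, k) * t $ l)"
    using t k by (intro transpose_mult_vec_entry unitriangularD(1)[OF A]) (auto simp: tail_vecs_def)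
  also have "\<dots> = 0"
  proof (rule sum.neutral, clarify)
    fix l assume "l < n"
    then show "A $$ (l, k) * t $ l = 0"
      using t k unitriangularD(2)[OF A, of k l] by (cases "l \<le> i") (auto simp: tail_vecs_def)
  qed
  finally show ?thesis .
qed

lemma fixed_rowsD:
  assumes "u \<in> fixed_rows A" "A \<in> unitriangular n"
  shows "u \<in> carrier_vec n" "transpose_mat A *\<^sub>v u = u"
  using assms unitriangularD(1)[OF assms(2)] by (auto simp: fixed_rows_def)

lemma fixed_rows_closed:
  assumes A: "A \<in> unitriangular n" and u: "u \<in> fixed_rows A" and v: "v \<in> fixed_rows A"
  shows "u - v \<in> fixed_rows A" "u + v \<in> fixed_rows A" "c \<cdot>\<^sub>v u \<in> fixed_rows A"
proof -
  note u = fixed_rowsD[OF u A] and v = fixed_rowsD[OF v A] and c = unitriangularD(1)[OF A]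
  show "u - v \<in> fixed_rows A" "u + v \<in> fixed_rows A" "c \<cdot>\<^sub>v u \<in> fixed_rows A"
    using u v c
    by (auto simp: fixed_rows_def mult_minus_distrib_mat_vec[of _ n n] mult_add_distrib_mat_vec[of _ n n]
      mult_mat_vec[of _ n n])
qed

section \<open>Counting solutions and completing the square\<close>

context add_char
begin

text \<open>This evaluates the contribution of one \<open>u\<close> to the supercharacter. Pairing
  with \<open>u\<close> shows that \<open>\<eta> w $ i\<close> is the same for every
  \<open>w\<close> satisfying the condition. The number of such \<open>w\<close> is found by writing
  the condition as a character sum over tail vectors \<open>t\<close> and summing over
  \<open>w\<close> first.\<close>

lemma sum_tail_vecs_cond:
  fixes A A' Y :: "'a mat"
  assumes A: "A \<in> unitriangular n" and A': "A' \<in> unitriangular n" and inv: "A * A' = 1\<^sub>m n"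
    and Y: "Y \<in> carrier_mat n n" and i: "i < n"
    and u: "u \<in> lead_vecs n i" "u \<in> fixed_rows A"
  defines "\<eta> \<equiv> \<lambda>w. Y *\<^sub>v u + (A' *\<^sub>v w - w)"
  shows "(\<Sum>w\<in>tail_vecs n i.
      if \<forall>k. i < k \<and> k < n \<longrightarrow> \<eta> w $ k = 0 then \<theta> (r * \<eta> w $ i) else 0) =
    \<theta> (r * (u \<bullet> (Y *\<^sub>v u))) * (\<Sum>t\<in>tail_vecs n i \<inter> fixed_rows A. \<theta> (t \<bullet> (Y *\<^sub>v u)))"
    (is "?L = ?R")
proof -
  let ?W = "tail_vecs n i :: 'a vec set"
  let ?N = "of_nat (card ?W) :: complex"
  let ?Z = "\<lambda>c :: 'a vec. \<forall>k. i < k \<and> k < n \<longrightarrow> c $ k = 0"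
  let ?T = "transpose_mat A'"
  have uc: "u \<in> carrier_vec n" using u by (simp add: lead_vecs_def)
  have A'c: "A' \<in> carrier_mat n n" by (rule unitriangularD(1)[OF A'])
  have Wc: "w \<in> carrier_vec n" if "w \<in> ?W" for w using that by (simp add: tail_vecs_def)
  have Yu: "Y *\<^sub>v u \<in> carrier_vec n" using Y uc by simp
  have \<eta>c: "\<eta> w \<in> carrier_vec n" if "w \<in> carrier_vec n" for w
    using that A'c Yu unfolding \<eta>_def by simp
  \<comment> \<open>Moving \<open>A'\<close> to the other side of the scalar product isolates the
    dependence on \<open>w\<close> in a single linear term.\<close>
  have pair: "v \<bullet> \<eta> w = v \<bullet> (Y *\<^sub>v u) + w \<bullet> (?T *\<^sub>v v - v)"
    if v: "v \<in> carrier_vec n" and w: "w \<in> carrier_vec n" for v w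
  proof -
    have "v \<bullet> (A' *\<^sub>v w) = w \<bullet> (?T *\<^sub>v v)"
      using transpose_vec_mult_scalar[OF A'c w v] A'c v w by (simp add: comm_scalar_prod[of _ n])
    then show ?thesis
      using v w Yu A'c unfolding \<eta>_def
      by (simp add: scalar_prod_add_distrib[of _ n] scalar_prod_minus_distrib[of _ n]
        comm_scalar_prod[of v n w])
  qed
  have fixed: "v \<in> fixed_rows A \<longleftrightarrow> ?T *\<^sub>v v = v" if "v \<in> carrier_vec n" for v
    using unitriangular_transpose_inverse[OF A A' inv that that] that unitriangularD(1)[OF A]
    by (auto simp: fixed_rows_def)
  \<comment> \<open>The vector \<open>u\<close> is also fixed by the inverse \<open>A'\<close>, so
    the term in \<open>w\<close> disappears from \<open>u \<bullet> \<eta> w\<close>.\<close>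
  have \<eta>i: "\<eta> w $ i = u \<bullet> (Y *\<^sub>v u)" if w: "w \<in> ?W" and "?Z (\<eta> w)" for w
  proof -
    have "u \<bullet> \<eta> w = \<eta> w $ i"
      using that by (intro lead_scalar_prod[OF u(1) \<eta>c[OF Wc[OF w]] i]) auto
    moreover have "?T *\<^sub>v u - u = 0\<^sub>v n"
      using fixed[OF uc] u(2) uc by simp
    ultimately show ?thesis
      using pair[OF uc Wc[OF w]] Wc[OF w] by simp
  qed
  have L: "?L = \<theta> (r * (u \<bullet> (Y *\<^sub>v u))) * (\<Sum>w\<in>?W. if ?Z (\<eta> w) then 1 else 0)"
    unfolding sum_distrib_left using \<eta>i by (intro sum.cong refl) auto
  \<comment> \<open>The left side only concerns places beyond \<open>i\<close>; in the other places
    both \<open>t\<close> and its image vanish.\<close>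
  have fixed_tail: "?Z (?T *\<^sub>v t - t) \<longleftrightarrow> t \<in> fixed_rows A" if t: "t \<in> ?W" for t
  proof
    assume z: "?Z (?T *\<^sub>v t - t)"
    have "?T *\<^sub>v t = t"
    proof (rule eq_vecI)
      fix k assume "k < dim_vec t"
      then have k: "k < n" using Wc[OF t] by simp
      show "(?T *\<^sub>v t) $ k = t $ k"
      proof (cases "k \<le> i")
        case True
        then show ?thesis
          using transpose_unitriangular_tail[OF A' t True k] t k by (simp add: tail_vecs_def)
      next
        case False
        then show ?thesis using z[rule_format, of k] k Wc[OF t] A'c by simp
      qed
    qed (use Wc[OF t] A'c in simp)
    then show "t \<in> fixed_rows A" using fixed[OF Wc[OF t]] by simp
  next
    assume "t \<in> fixed_rows A"
    then have "?T *\<^sub>v t = t" using fixed[OF Wc[OF t]] by simp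
    then show "?Z (?T *\<^sub>v t - t)" using Wc[OF t] by simp
  qed
  \<comment> \<open>Orthogonality in \<open>t\<close> replaces the indicator of the
    condition.\<close>
  have "?N * (\<Sum>w\<in>?W. if ?Z (\<eta> w) then 1 else 0) = (\<Sum>w\<in>?W. \<Sum>t\<in>?W. \<theta> (t \<bullet> \<eta> w))"
    unfolding sum_distrib_left
  proof (rule sum.cong)
    fix w assume w: "w \<in> ?W"
    show "?N * (if ?Z (\<eta> w) then 1 else 0) = (\<Sum>t\<in>?W. \<theta> (t \<bullet> \<eta> w))"
      unfolding sum_tail_vecs[OF \<eta>c[OF Wc[OF w]]]
      by (subst if_distrib[of "(*) ?N"]) (simp only: mult_1_right mult_zero_right)
  qed simp
  also have "\<dots> = (\<Sum>t\<in>?W. \<Sum>w\<in>?W. \<theta> (t \<bullet> \<eta> w))"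
    by (rule sum.swap)
  also have "\<dots> = (\<Sum>t\<in>?W. if t \<in> fixed_rows A then ?N * \<theta> (t \<bullet> (Y *\<^sub>v u)) else 0)"
  proof (rule sum.cong)
    fix t assume t: "t \<in> ?W"
    \<comment> \<open>Orthogonality in \<open>w\<close> leaves only those \<open>t\<close> that are
      fixed by \<open>A\<close>.\<close>
    have "(\<Sum>w\<in>?W. \<theta> (t \<bullet> \<eta> w)) = (\<Sum>w\<in>?W. \<theta> (t \<bullet> (Y *\<^sub>v u)) * \<theta> (w \<bullet> (?T *\<^sub>v t - t)))"
      by (intro sum.cong refl) (simp add: pair[OF Wc[OF t] Wc] add)
    also have "\<dots> = \<theta> (t \<bullet> (Y *\<^sub>v u)) * (if ?Z (?T *\<^sub>v t - t) then ?N else 0)"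
      unfolding sum_distrib_left[symmetric]
      using Wc[OF t] A'c by (subst sum_tail_vecs[of _ n]) auto
    finally show "(\<Sum>w\<in>?W. \<theta> (t \<bullet> \<eta> w)) =
        (if t \<in> fixed_rows A then ?N * \<theta> (t \<bullet> (Y *\<^sub>v u)) else 0)"
      using fixed_tail[OF t] by simp
  qed simp
  also have "\<dots> = ?N * (\<Sum>t\<in>?W \<inter> fixed_rows A. \<theta> (t \<bullet> (Y *\<^sub>v u)))"
    unfolding sum_distrib_left by (rule sum.inter_restrict[symmetric]) simp
  finally have "(\<Sum>w\<in>?W. if ?Z (\<eta> w) then 1 else 0) =
      (\<Sum>t\<in>?W \<inter> fixed_rows A. \<theta> (t \<bullet> (Y *\<^sub>v u)))"
    \<comment> \<open>The factor \<open>?N\<close> can be cancelled because the tail space contains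
      zero.\<close>
    using zero_in_tail_vecs[of n i, where 'a = 'a] by auto
  then show ?thesis using L by simp
qed

text \<open>
  Completing the square: substitute \<open>t = 2 r t'\<close> on the left and \<open>u = v - t'\<close>, \<open>t = r t'\<close>
  on the right.
\<close>

lemma sum_lead_tail_square:
  fixes A Y :: "'a mat"
  assumes A: "A \<in> unitriangular n" and Y: "Y \<in> carrier_mat n n" and sym: "transpose_mat Y = Y"
    and i: "i < n" and r: "r \<noteq> 0" and two: "(2::'a) \<noteq> 0"
  defines "Q \<equiv> \<lambda>u. u \<bullet> (Y *\<^sub>v u)"
    and "V \<equiv> lead_vecs n i \<inter> fixed_rows A" and "K \<equiv> tail_vecs n i \<inter> fixed_rows A"
  shows "(\<Sum>u\<in>V. \<theta> (r * Q u) * (\<Sum>t\<in>K. \<theta> (t \<bullet> (Y *\<^sub>v u)))) =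
    (\<Sum>u\<in>V. \<theta> (r * Q u)) * (\<Sum>t\<in>K. \<theta> (- inverse r * Q t))"
proof -
  have Vc: "u \<in> carrier_vec n" if "u \<in> V" for u using that by (auto simp: V_def lead_vecs_def)
  have Kc: "u \<in> carrier_vec n" if "u \<in> K" for u using that by (auto simp: K_def tail_vecs_def)
  have K_smult: "c \<cdot>\<^sub>v t \<in> K" if "t \<in> K" for c t
    using that fixed_rows_closed(3)[OF A, of t t c] tail_vecs_closed(3)[of t n i t c] by (auto simp: K_def)
  \<comment> \<open>Dilation by a nonzero scalar permutes the space \<open>K\<close>.\<close>
  have scale: "(\<Sum>t\<in>K. f t) = (\<Sum>t\<in>K. f (c \<cdot>\<^sub>v t))" if c: "c \<noteq> 0" for c and f :: "'a vec \<Rightarrow> complex"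
    by (rule sum.reindex_bij_witness[where j = "\<lambda>t. inverse c \<cdot>\<^sub>v t" and i = "\<lambda>t. c \<cdot>\<^sub>v t"])
      (use c in \<open>auto simp: smult_smult_assoc K_smult\<close>)
  have VK: "u + t \<in> V" "u - t \<in> V" if "u \<in> V" "t \<in> K" for u t
    using that i fixed_rows_closed[OF A, of u t]
    by (auto simp: V_def K_def lead_vecs_def tail_vecs_def)
  \<comment> \<open>By symmetry of \<open>Y\<close> the cross terms add up to
    \<open>2 * (t \<bullet> (Y *\<^sub>v u))\<close>. The contributions \<open>r * Q t\<close> and
    \<open>- inverse r * (r * r * Q t)\<close> cancel.\<close>
  have Q_add: "r * Q (u + t) + - inverse r * Q (r \<cdot>\<^sub>v t) = r * Q u + ((2 * r) \<cdot>\<^sub>v t) \<bullet> (Y *\<^sub>v u)"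
    if "u \<in> carrier_vec n" "t \<in> carrier_vec n" for u t
  proof -
    have "u \<bullet> (Y *\<^sub>v t) = t \<bullet> (Y *\<^sub>v u)"
      using transpose_vec_mult_scalar[OF Y that(2,1)] Y that
      by (simp add: sym comm_scalar_prod[of _ n])
    then have "Q (u + t) = Q u + 2 * (t \<bullet> (Y *\<^sub>v u)) + Q t"
      using that Y unfolding Q_def
      by (simp add: mult_add_distrib_mat_vec[of _ n n] scalar_prod_add_distrib[of _ n]
        add_scalar_prod_distrib[of _ n] algebra_simps)
    moreover have "Q (r \<cdot>\<^sub>v t) = r * r * Q t"
      using that Y unfolding Q_def by (simp add: mult_mat_vec[of _ n n])
    ultimately show ?thesis
      using r that Y by (simp add: field_simps)
  qed
  have "(\<Sum>u\<in>V. \<theta> (r * Q u) * (\<Sum>t\<in>K. \<theta> (t \<bullet> (Y *\<^sub>v u)))) =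
      (\<Sum>u\<in>V. \<Sum>t\<in>K. \<theta> (r * Q u) * \<theta> (((2 * r) \<cdot>\<^sub>v t) \<bullet> (Y *\<^sub>v u)))"
    using r two by (subst scale[of "2 * r"]) (auto simp: sum_distrib_left)
  also have "\<dots> = (\<Sum>u\<in>V. \<Sum>t\<in>K. \<theta> (r * Q (u + t)) * \<theta> (- inverse r * Q (r \<cdot>\<^sub>v t)))"
    unfolding add[symmetric] by (intro sum.cong refl) (simp only: Q_add[OF Vc Kc])
  also have "\<dots> = (\<Sum>t\<in>K. \<Sum>u\<in>V. \<theta> (r * Q (u + t)) * \<theta> (- inverse r * Q (r \<cdot>\<^sub>v t)))"
    by (rule sum.swap)
  also have "\<dots> = (\<Sum>t\<in>K. \<Sum>u\<in>V. \<theta> (r * Q u) * \<theta> (- inverse r * Q (r \<cdot>\<^sub>v t)))"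
  proof (rule sum.cong)
    fix t assume t: "t \<in> K"
    have "u - t + t = u" "u + t - t = u" if "u \<in> V" for u
      using Vc[OF that] Kc[OF t] by auto
    then show "(\<Sum>u\<in>V. \<theta> (r * Q (u + t)) * \<theta> (- inverse r * Q (r \<cdot>\<^sub>v t))) =
        (\<Sum>u\<in>V. \<theta> (r * Q u) * \<theta> (- inverse r * Q (r \<cdot>\<^sub>v t)))"
      by (intro sum.reindex_bij_witness[where j = "\<lambda>u. u + t" and i = "\<lambda>u. u - t"])
        (auto simp: VK[OF _ t])
  qed simp
  also have "\<dots> = (\<Sum>u\<in>V. \<theta> (r * Q u)) * (\<Sum>t\<in>K. \<theta> (- inverse r * Q (r \<cdot>\<^sub>v t)))"
    unfolding sum_product by (rule sum.swap)
  also have "(\<Sum>t\<in>K. \<theta> (- inverse r * Q (r \<cdot>\<^sub>v t))) = (\<Sum>t\<in>K. \<theta> (- inverse r * Q t))"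
    using scale[OF r, of "\<lambda>t. \<theta> (- inverse r * Q t)"] by simp
  finally show ?thesis .
qed

end

section \<open>Fixed tail vectors sorted by their leading entry\<close>

text \<open>A nonzero vector is uniquely \<open>c \<cdot>\<^sub>v u\<close> with \<open>u\<close> of
  leading entry 1: the place \<open>j\<close> is its first nonzero place and \<open>c\<close> is its
  entry there.\<close>

lemma sum_tail_fixed_rows:
  fixes A :: "'a::{field,finite} mat" and f :: "'a vec \<Rightarrow> 'b::comm_monoid_add"
  assumes A: "A \<in> unitriangular n"
  shows "(\<Sum>t\<in>tail_vecs n i \<inter> fixed_rows A. f t) =
    f (0\<^sub>v n) + (\<Sum>j\<in>{i<..<n}. \<Sum>u\<in>lead_vecs n j \<inter> fixed_rows A. \<Sum>c\<in>UNIV - {0}. f (c \<cdot>\<^sub>v u))"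
proof -
  let ?K = "tail_vecs n i \<inter> fixed_rows A" and ?V = "\<lambda>j. lead_vecs n j \<inter> fixed_rows A"
  let ?S = "Sigma {i<..<n} (\<lambda>j. ?V j \<times> (UNIV - {0}))"
  let ?h = "\<lambda>(j :: nat, u :: 'a vec, c). c \<cdot>\<^sub>v u"
  have z: "0\<^sub>v n \<in> ?K"
    using zero_in_tail_vecs[of n i] unitriangularD(1)[OF A] by (auto simp: fixed_rows_def)
  \<comment> \<open>At place \<open>j\<close> one vector has the entry \<open>c \<noteq> 0\<close>,
    while the other has 0 because its leading place comes later.\<close>
  have not_less: False
    if "u \<in> lead_vecs n j" "u' \<in> lead_vecs n j'" "j < j'" "j' < n" "c \<cdot>\<^sub>v u = c' \<cdot>\<^sub>v u'" "c \<noteq> 0"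
    for u u' :: "'a vec" and j j' c c'
  proof -
    have "(c \<cdot>\<^sub>v u) $ j = c" "(c' \<cdot>\<^sub>v u') $ j = 0"
      using that(1-4) by (auto simp: lead_vecs_def)
    then show False using that(5,6) by metis
  qed
  have "bij_betw ?h ?S (?K - {0\<^sub>v n})"
    unfolding bij_betw_def
  proof
    show "inj_on ?h ?S"
    proof (rule inj_onI)
      fix a b assume "a \<in> ?S" "b \<in> ?S" and h: "?h a = ?h b"
      moreover obtain j u c j' u' c' where ab: "a = (j, u, c)" "b = (j', u', c')"
        by (metis prod_cases3)
      ultimately have j: "j \<in> {i<..<n}" "j' \<in> {i<..<n}"
        and u: "u \<in> lead_vecs n j" "u' \<in> lead_vecs n j'"
        and c: "c \<noteq> 0" "c' \<noteq> 0" and eq: "c \<cdot>\<^sub>v u = c' \<cdot>\<^sub>v u'"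
        by auto
      have jj: "j = j'"
        using not_less[OF u _ _ eq] not_less[OF u(2,1) _ _ eq[symmetric]] j c
        by (cases j j' rule: linorder_cases) auto
      have "(c \<cdot>\<^sub>v u) $ j = c" "(c' \<cdot>\<^sub>v u') $ j = c'"
        using u j jj by (auto simp: lead_vecs_def)
      then have cc: "c = c'" using eq by simp
      have "u = inverse c \<cdot>\<^sub>v (c \<cdot>\<^sub>v u)" "u' = inverse c \<cdot>\<^sub>v (c \<cdot>\<^sub>v u')"
        using c by (simp_all add: smult_smult_assoc)
      then show "a = b"
        using ab jj cc eq by simp
    qed
    show "?h ` ?S = ?K - {0\<^sub>v n}"
    proof (intro subset_antisym subsetI)
      fix t assume "t \<in> ?h ` ?S"
      then obtain p where "p \<in> ?S" "t = ?h p" by blast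
      moreover obtain j u c where "p = (j, u, c)" by (metis prod_cases3)
      ultimately have t: "t = c \<cdot>\<^sub>v u" "j \<in> {i<..<n}" "u \<in> ?V j" "c \<noteq> 0" by auto
      then have "t $ j = c" "t \<in> tail_vecs n i"
        by (auto simp: lead_vecs_def tail_vecs_def)
      then show "t \<in> ?K - {0\<^sub>v n}"
        using t fixed_rows_closed(3)[OF A, of u u c] by auto
    next
      fix t assume t: "t \<in> ?K - {0\<^sub>v n}"
      then have tc: "t \<in> carrier_vec n" by (auto simp: tail_vecs_def)
      have "\<exists>k<n. t $ k \<noteq> 0"
      proof (rule ccontr)
        assume "\<not> (\<exists>k<n. t $ k \<noteq> 0)"
        then have "t = 0\<^sub>v n" using tc by (intro eq_vecI) auto
        then show False using t by simp
      qed
      then obtain j where j: "j < n" "t $ j \<noteq> 0" "\<forall>k<j. t $ k = 0"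
        using exists_least_iff[of "\<lambda>k. k < n \<and> t $ k \<noteq> 0"] by auto
      define u where "u = inverse (t $ j) \<cdot>\<^sub>v t"
      have "i < j" using j t by (auto simp: tail_vecs_def not_le[symmetric])
      moreover have "u \<in> ?V j"
        using j t tc fixed_rows_closed(3)[OF A, of t t] by (auto simp: u_def lead_vecs_def)
      moreover have "t = t $ j \<cdot>\<^sub>v u"
        using j by (simp add: u_def smult_smult_assoc)
      ultimately show "t \<in> ?h ` ?S"
        using j by (intro image_eqI[where x = "(j, u, t $ j)"]) auto
    qed
  qed
  from sum.reindex_bij_betw[OF this, of f]
  have "sum f (?K - {0\<^sub>v n}) =
      (\<Sum>j\<in>{i<..<n}. \<Sum>u\<in>?V j. \<Sum>c\<in>UNIV - {0}. f (c \<cdot>\<^sub>v u))"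
    by (simp add: sum.Sigma sum.cartesian_product case_prod_unfold)
  then show ?thesis
    using z by (subst sum.remove[of _ "0\<^sub>v n"]) auto
qed

text \<open>Every nonzero square has exactly two roots \<open>t\<close> and \<open>- t\<close>,
  which differ since 2 is invertible. This is the source of the factor 2 in the restriction
  formula.\<close>

lemma sum_nonzero_squares:
  fixes h :: "'a::{field,finite} \<Rightarrow> complex"
  assumes two: "(2::'a) \<noteq> 0"
  shows "2 * (\<Sum>s\<in>nonzero_squares. h s) = (\<Sum>c\<in>UNIV - {0}. h (c\<^sup>2))"
proof -
  have img: "nonzero_squares = (\<lambda>c::'a. c\<^sup>2) ` (UNIV - {0})"
    by (auto simp: nonzero_squares_def)
  have card: "card {c \<in> UNIV - {0}. c\<^sup>2 = s} = 2" if s: "s \<in> nonzero_squares" for s :: 'a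
  proof -
    obtain t where t: "s = t\<^sup>2" "t \<noteq> 0" using s by (auto simp: nonzero_squares_def)
    have "{c \<in> UNIV - {0}. c\<^sup>2 = s} = {t, - t}"
      using t by (auto simp: power2_eq_iff)
    moreover have "t \<noteq> - t"
    proof
      assume "t = - t"
      then have "2 * t = 0" by (metis add.right_inverse mult_2)
      then show False using two t by simp
    qed
    ultimately show ?thesis by simp
  qed
  have "(\<Sum>c\<in>UNIV - {0}. h (c\<^sup>2)) =
      (\<Sum>s\<in>nonzero_squares. \<Sum>c\<in>{c \<in> UNIV - {0}. c\<^sup>2 = s}. h (c\<^sup>2))"
    unfolding img by (rule sum.image_gen) simp
  also have "\<dots> = (\<Sum>s\<in>nonzero_squares. 2 * h s)"
    using card by (intro sum.cong refl) simp
  finally show ?thesis by (simp add: sum_distrib_left)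
qed

context add_char
begin

text \<open>Scaling a vector by \<open>c\<close> scales \<open>Q\<close> by the square of
  \<open>c\<close>, so each sum over \<open>c\<close> is twice a sum over squares. The zero vector
  contributes the summand 1.\<close>

lemma sum_tail_fixed_rows_square:
  fixes A Y :: "'a mat"
  assumes A: "A \<in> unitriangular n" and Y: "Y \<in> carrier_mat n n"
    and r: "r \<noteq> 0" and two: "(2::'a) \<noteq> 0"
  defines "Q \<equiv> \<lambda>u. u \<bullet> (Y *\<^sub>v u)"
  shows "(\<Sum>t\<in>tail_vecs n i \<inter> fixed_rows A. \<theta> (- inverse r * Q t)) =
    1 + 2 * (\<Sum>j\<in>{i<..<n}. \<Sum>s\<in>(\<lambda>t. - inverse r * t) ` nonzero_squares.
      \<Sum>u\<in>lead_vecs n j \<inter> fixed_rows A. \<theta> (s * Q u))"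
proof -
  have Q0: "Q (0\<^sub>v n) = 0" using Y by (simp add: Q_def)
  have Qs: "Q (c \<cdot>\<^sub>v u) = c\<^sup>2 * Q u" if "u \<in> carrier_vec n" for c u
    using that Y by (simp add: Q_def mult_mat_vec[of _ n n] power2_eq_square)
  have inj: "inj_on (\<lambda>t. - inverse r * t) nonzero_squares"
    using r by (auto simp: inj_on_def)
  have "(\<Sum>u\<in>lead_vecs n j \<inter> fixed_rows A. \<Sum>c\<in>UNIV - {0}. \<theta> (- inverse r * Q (c \<cdot>\<^sub>v u))) =
      2 * (\<Sum>s\<in>(\<lambda>t. - inverse r * t) ` nonzero_squares.
        \<Sum>u\<in>lead_vecs n j \<inter> fixed_rows A. \<theta> (s * Q u))" (is "?L = ?R") for j
  proof -
    have "?L = (\<Sum>u\<in>lead_vecs n j \<inter> fixed_rows A.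
        2 * (\<Sum>s\<in>nonzero_squares. \<theta> (- inverse r * s * Q u)))"
      unfolding sum_nonzero_squares[OF two] by (intro sum.cong refl) (auto simp: Qs lead_vecs_def mult.assoc)
    also have "\<dots> = 2 * (\<Sum>s\<in>nonzero_squares.
        \<Sum>u\<in>lead_vecs n j \<inter> fixed_rows A. \<theta> (- inverse r * s * Q u))"
      unfolding sum_distrib_left[symmetric] by (subst sum.swap) (rule refl)
    finally show ?thesis unfolding sum.reindex[OF inj] o_def .
  qed
  then show ?thesis
    unfolding sum_tail_fixed_rows[OF A] Q0 by (simp add: sum_distrib_left)
qed

end

section \<open>Blocks of matrices and halves of rows\<close>

text \<open>
  With zero-based positions, the index \<open>-k\<close> sits at position \<open>2n - k\<close>; reversing the second
  half of rows and columns absorbs the conjugations by \<open>J\<close>.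
\<close>

definition ul_block :: "nat \<Rightarrow> 'a mat \<Rightarrow> 'a mat" where
  "ul_block n x = mat n n (\<lambda>(a, b). x $$ (a, b))"

definition ur_block :: "nat \<Rightarrow> 'a mat \<Rightarrow> 'a mat" where
  "ur_block n x = mat n n (\<lambda>(a, b). x $$ (a, 2 * n - 1 - b))"

text \<open>A transposition is built in as well: on elements of \<open>sylow_Sp n\<close> this is
  the inverse of \<open>ul_block n x\<close>.\<close>

definition lr_block :: "nat \<Rightarrow> 'a mat \<Rightarrow> 'a mat" where
  "lr_block n x = mat n n (\<lambda>(a, b). x $$ (2 * n - 1 - b, 2 * n - 1 - a))"

definition fst_half :: "nat \<Rightarrow> 'a vec \<Rightarrow> 'a vec" where
  "fst_half n v = vec n (\<lambda>k. v $ k)"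

definition rev_half :: "nat \<Rightarrow> 'a vec \<Rightarrow> 'a vec" where
  "rev_half n v = vec n (\<lambda>k. v $ (2 * n - 1 - k))"

lemma block_carrier [simp]:
  "ul_block n x \<in> carrier_mat n n" "ur_block n x \<in> carrier_mat n n" "lr_block n x \<in> carrier_mat n n"
  "fst_half n v \<in> carrier_vec n" "rev_half n v \<in> carrier_vec n"
  by (simp_all add: ul_block_def ur_block_def lr_block_def fst_half_def rev_half_def)

lemma block_unitriangular:
  assumes x: "x \<in> unitriangular (2 * n)"
  shows "ul_block n x \<in> unitriangular n" "lr_block n x \<in> unitriangular n"
  using unitriangularD[OF x] by (auto simp: unitriangular_def ul_block_def lr_block_def)

lemma sum_halves:
  fixes f :: "nat \<Rightarrow> 'b::comm_monoid_add"
  shows "(\<Sum>l<2 * n. f l) = (\<Sum>l<n. f l) + (\<Sum>l<n. f (2 * n - 1 - l))"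
proof -
  have "{..<2 * n} = {..<n} \<union> {n..<2 * n}" by auto
  then have "(\<Sum>l<2 * n. f l) = (\<Sum>l<n. f l) + (\<Sum>l\<in>{n..<2 * n}. f l)"
    by (simp add: sum.union_disjoint ivl_disj_int)
  also have "(\<Sum>l\<in>{n..<2 * n}. f l) = (\<Sum>l<n. f (2 * n - 1 - l))"
    by (rule sum.reindex_bij_witness[where j = "\<lambda>l. 2 * n - 1 - l" and i = "\<lambda>l. 2 * n - 1 - l"]) auto
  finally show ?thesis .
qed

text \<open>The product of the row \<open>v\<close> with \<open>x\<close>, read in halves. The lower
  left block vanishes by triangularity, and \<open>lr_block\<close> acts without a transpose because
  it is already transposed.\<close>

lemma block_row_mult:
  assumes x: "x \<in> unitriangular (2 * n)" and v: "v \<in> carrier_vec (2 * n)"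
  shows "fst_half n (transpose_mat x *\<^sub>v v) = transpose_mat (ul_block n x) *\<^sub>v fst_half n v"
    and "rev_half n (transpose_mat x *\<^sub>v v) =
      transpose_mat (ur_block n x) *\<^sub>v fst_half n v + lr_block n x *\<^sub>v rev_half n v"
proof -
  note xD = unitriangularD[OF x]
  show "fst_half n (transpose_mat x *\<^sub>v v) = transpose_mat (ul_block n x) *\<^sub>v fst_half n v"
  proof (rule eq_vecI)
    fix k assume "k < dim_vec (transpose_mat (ul_block n x) *\<^sub>v fst_half n v)"
    then have k: "k < n" by (simp add: ul_block_def)
    have "fst_half n (transpose_mat x *\<^sub>v v) $ k = (\<Sum>l<2 * n. x $$ (l, k) * v $ l)"
      using k transpose_mult_vec_entry[OF xD(1) v, of k] by (simp add: fst_half_def)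
    also have "\<dots> = (\<Sum>l<n. x $$ (l, k) * v $ l)"
      unfolding sum_halves using k xD(2) by simp
    also have "\<dots> = (transpose_mat (ul_block n x) *\<^sub>v fst_half n v) $ k"
      using k by (subst transpose_mult_vec_entry[of _ n]) (auto simp: ul_block_def fst_half_def)
    finally show "fst_half n (transpose_mat x *\<^sub>v v) $ k =
        (transpose_mat (ul_block n x) *\<^sub>v fst_half n v) $ k" .
  qed (simp add: ul_block_def fst_half_def)
  show "rev_half n (transpose_mat x *\<^sub>v v) =
      transpose_mat (ur_block n x) *\<^sub>v fst_half n v + lr_block n x *\<^sub>v rev_half n v"
  proof (rule eq_vecI)
    fix k assume "k < dim_vec (transpose_mat (ur_block n x) *\<^sub>v fst_half n v +
      lr_block n x *\<^sub>v rev_half n v)"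
    then have k: "k < n" by (simp add: lr_block_def)
    let ?k = "2 * n - 1 - k"
    have "rev_half n (transpose_mat x *\<^sub>v v) $ k = (\<Sum>l<2 * n. x $$ (l, ?k) * v $ l)"
      using k transpose_mult_vec_entry[OF xD(1) v, of ?k] by (simp add: rev_half_def)
    also have "\<dots> = (\<Sum>l<n. x $$ (l, ?k) * v $ l) +
        (\<Sum>l<n. x $$ (2 * n - 1 - l, ?k) * v $ (2 * n - 1 - l))"
      by (rule sum_halves)
    also have "(\<Sum>l<n. x $$ (l, ?k) * v $ l) = (transpose_mat (ur_block n x) *\<^sub>v fst_half n v) $ k"
      using k by (subst transpose_mult_vec_entry[of _ n]) (auto simp: ur_block_def fst_half_def)
    also have "(\<Sum>l<n. x $$ (2 * n - 1 - l, ?k) * v $ (2 * n - 1 - l)) =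
        (lr_block n x *\<^sub>v rev_half n v) $ k"
      using k by (simp add: lr_block_def rev_half_def scalar_prod_def atLeast0LessThan)
    finally show "rev_half n (transpose_mat x *\<^sub>v v) $ k =
        (transpose_mat (ur_block n x) *\<^sub>v fst_half n v + lr_block n x *\<^sub>v rev_half n v) $ k"
      using k by (simp add: lr_block_def)
  qed (simp add: lr_block_def rev_half_def)
qed

lemma mult_antidiag_entry:
  assumes "A \<in> carrier_mat n n" "a < n" "b < n"
  shows "(A * antidiag n) $$ (a, b) = A $$ (a, n - 1 - b)"
proof -
  have "(A * antidiag n) $$ (a, b) = (\<Sum>c<n. A $$ (a, c) * antidiag n $$ (c, b))"
    using assms by (intro mat_mult_entry) auto
  also have "\<dots> = (\<Sum>c<n. if c = n - 1 - b then A $$ (a, c) else 0)"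
    using assms by (intro sum.cong) (auto simp: antidiag_def)
  finally show ?thesis using assms by simp
qed

text \<open>Here \<open>Y = z J\<close>. As \<open>J\<close> is symmetric, the condition on
  \<open>z\<close> says precisely that \<open>Y\<close> is symmetric.\<close>

lemma sylow_Sp_blocks:
  fixes x :: "'a::field mat"
  assumes "x \<in> sylow_Sp n"
  obtains Y where "ul_block n x * lr_block n x = 1\<^sub>m n" "Y \<in> carrier_mat n n" "transpose_mat Y = Y"
    "ur_block n x = ul_block n x * Y"
proof -
  let ?J = "antidiag n :: 'a mat"
  from assms obtain a a' z where x: "x = four_block_mat a (a * z) (0\<^sub>m n n) (?J * transpose_mat a' * ?J)"
    and a: "a \<in> unitriangular n" "a' \<in> carrier_mat n n" "a * a' = 1\<^sub>m n" and z: "z \<in> carrier_mat n n"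
    and zJ: "?J * transpose_mat z - z * ?J = 0\<^sub>m n n"
    unfolding sylow_Sp_block_form by blast
  have ac: "a \<in> carrier_mat n n" by (rule unitriangularD(1)[OF a(1)])
  have ul: "ul_block n x = a"
    by (rule eq_matI) (use ac in \<open>auto simp: ul_block_def x\<close>)
  have D: "(?J * transpose_mat a' * ?J) $$ (p, q) = a' $$ (n - 1 - q, n - 1 - p)" if "p < n" "q < n" for p q
    using that a antidiag_conj_entry[of "transpose_mat a'" n p q] by simp
  have Dc: "?J * transpose_mat a' * ?J \<in> carrier_mat n n"
    using a by (intro mult_carrier_mat[of _ n n]) auto
  have lr: "lr_block n x = a'"
  proof (rule eq_matI)
    fix p q assume "p < dim_row a'" "q < dim_col a'"
    then have pq: "p < n" "q < n" using a by auto
    then have "lr_block n x $$ (p, q) = (?J * transpose_mat a' * ?J) $$ (n - 1 - q, n - 1 - p)"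
      using ac Dc by (auto simp: lr_block_def x simp del: index_mult_mat intro!: arg_cong[where f = "index_mat _"])
    then show "lr_block n x $$ (p, q) = a' $$ (p, q)"
      using pq by (simp add: D del: index_mult_mat)
  qed (use a in \<open>auto simp: lr_block_def\<close>)
  have az: "a * z \<in> carrier_mat n n" using ac z by simp
  have "ur_block n x = a * z * ?J"
  proof (rule eq_matI)
    fix p q assume "p < dim_row (a * z * ?J)" "q < dim_col (a * z * ?J)"
    then have pq: "p < n" "q < n" using ac by (auto simp: antidiag_def)
    then have "ur_block n x $$ (p, q) = (a * z) $$ (p, n - 1 - q)"
      using ac az Dc by (auto simp: ur_block_def x simp del: index_mult_mat intro!: arg_cong[where f = "index_mat _"])
    then show "ur_block n x $$ (p, q) = (a * z * ?J) $$ (p, q)"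
      using mult_antidiag_entry[OF az pq] by simp
  qed (use ac in \<open>auto simp: ur_block_def antidiag_def\<close>)
  also have "\<dots> = a * (z * ?J)"
    using ac z by (intro assoc_mult_mat[of _ n n _ n _ n]) auto
  finally have ur: "ur_block n x = a * (z * ?J)" .
  have "transpose_mat (z * ?J) = ?J * transpose_mat z"
    using z by (simp add: transpose_mult[of _ n n _ n])
  also have "\<dots> = (?J * transpose_mat z - z * ?J) + z * ?J"
    using z by (intro eq_matI) (auto simp: antidiag_def)
  also have "\<dots> = z * ?J"
    unfolding zJ using z by (intro left_add_zero_mat[of _ n n] mult_carrier_mat[of _ n n]) auto
  finally have sym: "transpose_mat (z * ?J) = z * ?J" .
  have "z * ?J \<in> carrier_mat n n" using z by (intro mult_carrier_mat[of _ n n]) auto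
  then show thesis
    using that sym ul lr ur a by simp
qed

section \<open>Prescribed rows and the inducing subgroups\<close>

lemma unitriangular_row_lead:
  "x \<in> unitriangular m \<Longrightarrow> i < m \<Longrightarrow> row x i \<in> lead_vecs m i"
  using unitriangularD[of x m] by (auto simp: lead_vecs_def)

lemma unitriangular_with_row:
  assumes v: "v \<in> lead_vecs m i" and i: "i < m"
  obtains h where "h \<in> unitriangular m" "row h i = v"
proof
  let ?h = "mat m m (\<lambda>(a, b). if a = i then v $ b else if a = b then 1 else 0)"
  show "?h \<in> unitriangular m"
    using v i by (auto simp: unitriangular_def lead_vecs_def)
  show "row ?h i = v"
    using v i by (intro eq_vecI) (auto simp: lead_vecs_def)
qed

text \<open>The block diagonal elements, with \<open>z = 0\<close>, already realise every admissible
  first half of row \<open>i\<close>.\<close>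

lemma sylow_Sp_with_row:
  fixes u :: "'a::field vec"
  assumes u: "u \<in> lead_vecs n i" and i: "i < n"
  obtains g where "g \<in> sylow_Sp n" "fst_half n (row g i) = u"
proof -
  obtain h where h: "h \<in> unitriangular n" "row h i = u"
    by (rule unitriangular_with_row[OF u i])
  note hc = unitriangularD(1)[OF h(1)]
  obtain h' where h': "h' \<in> carrier_mat n n" "h * h' = 1\<^sub>m n"
    using GL_right_inverse[of h n] h(1) unitriangular_subset_GL[of n] by blast
  let ?g = "four_block_mat h (h * 0\<^sub>m n n) (0\<^sub>m n n) (antidiag n * transpose_mat h' * antidiag n)"
  have "?g \<in> sylow_Sp n"
    unfolding sylow_Sp_block_form using h h'
    by (intro CollectI exI[of _ h] exI[of _ h'] exI[of _ "0\<^sub>m n n"])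
      (auto simp: left_mult_zero_mat[of _ n n] right_mult_zero_mat[of _ n n])
  moreover have "fst_half n (row ?g i) = u"
    using h hc i by (intro eq_vecI) (auto simp: fst_half_def)
  ultimately show thesis by (rule that)
qed

lemma row_mult_eq_transpose:
  fixes y g :: "'a::comm_semiring_0 mat"
  assumes "y \<in> carrier_mat m m" "g \<in> carrier_mat m m" "i < m"
  shows "row (y * g) i = transpose_mat g *\<^sub>v row y i"
  using assms by (intro eq_vecI) (auto intro!: comm_scalar_prod[of _ m])

text \<open>Entry \<open>k\<close> of the row \<open>\<eta> g\<close> is \<open>\<eta> $ k\<close>
  plus a combination of earlier entries of \<open>\<eta>\<close>, so the first nonzero place and the
  entry there are preserved. This carries conditions on a row of \<open>y\<close> over to the
  corresponding row of \<open>y g\<close>.\<close>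

lemma transpose_unitriangular_prefix:
  assumes g: "g \<in> unitriangular m" and \<eta>: "\<eta> \<in> carrier_vec m" and c: "c \<le> m"
  shows "(\<forall>k<c. (transpose_mat g *\<^sub>v \<eta>) $ k = 0) \<longleftrightarrow> (\<forall>k<c. \<eta> $ k = 0)"
    and "c < m \<Longrightarrow> \<forall>k<c. \<eta> $ k = 0 \<Longrightarrow> (transpose_mat g *\<^sub>v \<eta>) $ c = \<eta> $ c"
proof -
  note gD = unitriangularD[OF g]
  have *: "(transpose_mat g *\<^sub>v \<eta>) $ k = \<eta> $ k" if k: "k < m" and z: "\<forall>l<k. \<eta> $ l = 0" for k
  proof -
    have "(transpose_mat g *\<^sub>v \<eta>) $ k = (\<Sum>l<m. g $$ (l, k) * \<eta> $ l)"
      by (rule transpose_mult_vec_entry[OF gD(1) \<eta> k])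
    also have "\<dots> = (\<Sum>l<m. if l = k then \<eta> $ k else 0)"
    proof (rule sum.cong)
      fix l assume "l \<in> {..<m}"
      then show "g $$ (l, k) * \<eta> $ l = (if l = k then \<eta> $ k else 0)"
        using z k gD(2)[of k l] gD(3)[of k] by (cases l k rule: linorder_cases) auto
    qed simp
    finally show ?thesis using k by simp
  qed
  show "c < m \<Longrightarrow> \<forall>k<c. \<eta> $ k = 0 \<Longrightarrow> (transpose_mat g *\<^sub>v \<eta>) $ c = \<eta> $ c"
    by (rule *)
  show "(\<forall>k<c. (transpose_mat g *\<^sub>v \<eta>) $ k = 0) \<longleftrightarrow> (\<forall>k<c. \<eta> $ k = 0)"
  proof
    assume L: "\<forall>k<c. (transpose_mat g *\<^sub>v \<eta>) $ k = 0"
    have "k < c \<longrightarrow> \<eta> $ k = 0" for k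
    proof (induction k rule: less_induct)
      case (less k)
      then show ?case using *[of k] L c by force
    qed
    then show "\<forall>k<c. \<eta> $ k = 0" by blast
  next
    assume "\<forall>k<c. \<eta> $ k = 0"
    then show "\<forall>k<c. (transpose_mat g *\<^sub>v \<eta>) $ k = 0" using * c by auto
  qed
qed

text \<open>The one-based index \<open>int k + 1\<close> has zero-based position \<open>k\<close>.
  The last rule repeats the second for the expanded negation.\<close>

lemma pos_simps:
  "pos n (int k + 1) = k"
  "k < n \<Longrightarrow> pos n (- (int k + 1)) = 2 * n - 1 - k"
  "k < n \<Longrightarrow> pos n (- int k - 1) = 2 * n - 1 - k"
  by (auto simp: pos_def)

lemma U_long_iff:
  assumes i: "i < n"
  shows "y \<in> U_long n (int i + 1) \<longleftrightarrow> y \<in> sylow_Sp n \<and> fst_half n (row y i) = unit_vec n i"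
proof (cases "y \<in> sylow_Sp n")
  case True
  then have y: "y \<in> unitriangular (2 * n)" by (simp add: sylow_Sp_def)
  note yD = unitriangularD[OF y]
  have row: "fst_half n (row y i) $ k = y $$ (i, k)" if "k < n" for k
    using that i yD(1) by (auto simp: fst_half_def)
  have "(\<forall>k. int i + 1 < k \<and> k \<le> int n \<longrightarrow> entry n y (int i + 1) k = 0) \<longleftrightarrow>
      (\<forall>k<n. i < k \<longrightarrow> y $$ (i, k) = 0)" (is "?L \<longleftrightarrow> ?R")
  proof
    assume L: ?L
    show ?R
    proof (intro allI impI)
      fix k assume "k < n" "i < k"
      then show "y $$ (i, k) = 0"
        using L[rule_format, of "int k + 1"] by (simp add: entry_def pos_simps)
    qed
  next
    assume R: ?R
    show ?L
    proof (intro allI impI)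
      fix k assume "int i + 1 < k \<and> k \<le> int n"
      then show "entry n y (int i + 1) k = 0"
        using R[rule_format, of "nat (k - 1)"] by (auto simp: entry_def pos_def)
    qed
  qed
  also have "\<dots> \<longleftrightarrow> fst_half n (row y i) = unit_vec n i"
  proof
    assume R: "\<forall>k<n. i < k \<longrightarrow> y $$ (i, k) = 0"
    show "fst_half n (row y i) = unit_vec n i"
    proof (rule eq_vecI)
      fix k assume "k < dim_vec (unit_vec n i :: 'a vec)"
      then show "fst_half n (row y i) $ k = unit_vec n i $ k"
        using R i row[of k] yD(2)[of k i] yD(3)[of i]
        by (cases k i rule: linorder_cases) auto
    qed (simp add: fst_half_def)
  next
    assume "fst_half n (row y i) = unit_vec n i"
    then show "\<forall>k<n. i < k \<longrightarrow> y $$ (i, k) = 0"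
      using row i by (metis index_unit_vec(1) less_irrefl)
  qed
  finally show ?thesis using True by (simp add: U_long_def)
qed (simp add: U_long_def)

text \<open>The index opposite to \<open>i\<close> has position \<open>2 * n - 1 - i\<close>.
  Subtracting the unit vector removes the diagonal 1, so membership becomes the vanishing of a
  prefix, a condition that unitriangular matrices respect.\<close>

lemma \<zeta>_sub_iff:
  assumes i: "i < n"
  shows "y \<in> \<zeta>_sub n (int i + 1) \<longleftrightarrow>
    y \<in> unitriangular (2 * n) \<and> (\<forall>k<2 * n - 1 - i. (row y i - unit_vec (2 * n) i) $ k = 0)"
proof (cases "y \<in> unitriangular (2 * n)")
  case True
  note yD = unitriangularD[OF True]
  have "(\<forall>k\<in>signed_indices n. prec n (int i + 1) k \<and> prec n k (- (int i + 1)) \<longrightarrow>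
      entry n y (int i + 1) k = 0) \<longleftrightarrow> (\<forall>k. i < k \<and> k < 2 * n - 1 - i \<longrightarrow> y $$ (i, k) = 0)"
    (is "?L \<longleftrightarrow> ?R")
  proof
    assume L: ?L
    show ?R
    proof (intro allI impI)
      fix k assume k: "i < k \<and> k < 2 * n - 1 - i"
      \<comment> \<open>The signed index whose position is \<open>k\<close>.\<close>
      define l where "l = (if k < n then int k + 1 else int k - 2 * int n)"
      have "l \<in> signed_indices n" "pos n l = k"
        using k by (auto simp: l_def signed_indices_def pos_def)
      then show "y $$ (i, k) = 0"
        using L k i by (auto simp: entry_def prec_def pos_simps)
    qed
  next
    assume ?R
    then show ?L using i by (auto simp: entry_def prec_def pos_simps)
  qed
  also have "\<dots> \<longleftrightarrow> (\<forall>k<2 * n - 1 - i. (row y i - unit_vec (2 * n) i) $ k = 0)"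
  proof -
    have "(row y i - unit_vec (2 * n) i) $ k = (if i < k then y $$ (i, k) else 0)" if "k < 2 * n" for k
      using that i yD(1) yD(2)[of k i] yD(3)[of i] by (cases k i rule: linorder_cases) auto
    then have "(\<forall>k<2 * n - 1 - i. (row y i - unit_vec (2 * n) i) $ k = 0) \<longleftrightarrow>
        (\<forall>k<2 * n - 1 - i. (if i < k then y $$ (i, k) else 0) = 0)"
      by (intro all_cong) simp
    then show ?thesis by auto
  qed
  finally show ?thesis using True by (simp add: \<zeta>_sub_def)
qed (simp add: \<zeta>_sub_def)

lemma transpose_mult_unit_vec:
  fixes M :: "'a::comm_semiring_1 mat"
  assumes "M \<in> carrier_mat m m" "i < m"
  shows "transpose_mat M *\<^sub>v unit_vec m i = row M i"
  using assms by (intro eq_vecI) auto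

lemma row_ul_ur_block:
  assumes "x \<in> carrier_mat (2 * n) (2 * n)" "i < n"
  shows "row (ul_block n x) i = fst_half n (row x i)" "row (ur_block n x) i = rev_half n (row x i)"
  using assms by (auto simp: ul_block_def ur_block_def fst_half_def rev_half_def intro!: eq_vecI)

lemma fst_half_row_lead:
  assumes "x \<in> unitriangular (2 * n)" "i < n"
  shows "fst_half n (row x i) \<in> lead_vecs n i"
  using unitriangular_row_lead[of "ul_block n x" n i] block_unitriangular[OF assms(1)]
    row_ul_ur_block[OF unitriangularD(1)[OF assms(1)] assms(2)] assms by simp

section \<open>The characters of the long roots as sums over fixed rows\<close>

text \<open>Compare row \<open>i\<close> on both sides of \<open>y g = g x\<close>. The upper left
  block of \<open>g\<close> sends the unit vector to \<open>u\<close>, and it sends the first half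
  of the row of \<open>y\<close> to the image of \<open>u\<close> under that block of
  \<open>x\<close>; this gives the criterion. The second halves then determine the entry.\<close>

lemma sylow_Sp_conj_entry:
  fixes x g y :: "'a::field mat"
  assumes x: "x \<in> sylow_Sp n" and g: "g \<in> sylow_Sp n" and y: "y \<in> sylow_Sp n"
    and eq: "y * g = g * x" and i: "i < n"
  defines "u \<equiv> fst_half n (row g i)"
  shows "fst_half n (row y i) = unit_vec n i \<longleftrightarrow> u \<in> fixed_rows (ul_block n x)"
    and "u \<in> fixed_rows (ul_block n x) \<Longrightarrow>
      y $$ (i, 2 * n - 1 - i) = u \<bullet> (transpose_mat (ur_block n x) *\<^sub>v u)"
proof -
  have u: "x \<in> unitriangular (2 * n)" "g \<in> unitriangular (2 * n)" "y \<in> unitriangular (2 * n)"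
    using x g y by (auto simp: sylow_Sp_def)
  note c = unitriangularD(1)[OF u(1)] unitriangularD(1)[OF u(2)] unitriangularD(1)[OF u(3)]
  note xb = block_unitriangular[OF u(1)] and gb = block_unitriangular[OF u(2)]
  have xinv: "ul_block n x * lr_block n x = 1\<^sub>m n" and ginv: "ul_block n g * lr_block n g = 1\<^sub>m n"
    using sylow_Sp_blocks[OF x] sylow_Sp_blocks[OF g] by blast+
  define \<rho> where "\<rho> = row y i"
  define v where "v = row g i"
  have i2: "i < 2 * n" using i by simp
  have \<rho>c: "\<rho> \<in> carrier_vec (2 * n)" and vc: "v \<in> carrier_vec (2 * n)"
    unfolding \<rho>_def v_def using row_carrier_vec[OF i2] c by blast+
  have uc: "u \<in> carrier_vec n" by (simp add: u_def)
  have rows: "transpose_mat g *\<^sub>v \<rho> = transpose_mat x *\<^sub>v v"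
    using row_mult_eq_transpose[OF c(3,2) i2] row_mult_eq_transpose[OF c(2,1) i2] eq
    by (simp add: \<rho>_def v_def)
  have e: "transpose_mat (ul_block n g) *\<^sub>v unit_vec n i = u"
    using transpose_mult_unit_vec[of "ul_block n g" n i] i row_ul_ur_block[OF c(2) i]
    by (simp add: u_def)
  have fst: "transpose_mat (ul_block n g) *\<^sub>v fst_half n \<rho> = transpose_mat (ul_block n x) *\<^sub>v u"
    using block_row_mult(1)[OF u(2) \<rho>c] block_row_mult(1)[OF u(1) vc] rows
    by (simp add: u_def v_def)
  have Au: "transpose_mat (ul_block n x) *\<^sub>v u \<in> carrier_vec n"
    using uc by (metis block_carrier(1) mult_mat_vec_carrier transpose_carrier_mat)
  have "fst_half n \<rho> = transpose_mat (lr_block n g) *\<^sub>v (transpose_mat (ul_block n x) *\<^sub>v u)"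
    using unitriangular_transpose_inverse[OF gb ginv block_carrier(4) Au] fst by simp
  moreover have e': "unit_vec n i = transpose_mat (lr_block n g) *\<^sub>v u"
    using unitriangular_transpose_inverse[OF gb ginv, of "unit_vec n i" u] e uc by simp
  ultimately have unit_iff: "fst_half n \<rho> = unit_vec n i \<longleftrightarrow> transpose_mat (ul_block n x) *\<^sub>v u = u"
    using fst e by metis
  also have "\<dots> \<longleftrightarrow> u \<in> fixed_rows (ul_block n x)"
    using uc by (simp add: fixed_rows_def ul_block_def)
  finally have iff: "fst_half n \<rho> = unit_vec n i \<longleftrightarrow> u \<in> fixed_rows (ul_block n x)" .
  then show "fst_half n (row y i) = unit_vec n i \<longleftrightarrow> u \<in> fixed_rows (ul_block n x)"
    by (simp add: \<rho>_def)
  assume fixed: "u \<in> fixed_rows (ul_block n x)"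
  let ?Xu = "transpose_mat (ur_block n x) *\<^sub>v u"
  have Xu: "?Xu \<in> carrier_vec n"
    using uc by (metis block_carrier(2) mult_mat_vec_carrier transpose_carrier_mat)
  have "transpose_mat (ur_block n g) *\<^sub>v unit_vec n i = rev_half n v"
    using transpose_mult_unit_vec[of "ur_block n g" n i] i row_ul_ur_block[OF c(2) i]
    by (simp add: v_def)
  moreover have "fst_half n \<rho> = unit_vec n i" using fixed iff by simp
  ultimately have "rev_half n v + lr_block n g *\<^sub>v rev_half n \<rho> = ?Xu + lr_block n x *\<^sub>v rev_half n v"
    using block_row_mult(2)[OF u(2) \<rho>c] block_row_mult(2)[OF u(1) vc] rows
    by (simp add: u_def v_def)
  \<comment> \<open>Pairing with \<open>u\<close> eliminates the second half of the row of
    \<open>g\<close>: the block of \<open>x\<close> fixes \<open>u\<close>, so the terms in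
    \<open>rev_half n v\<close> cancel, while the block of \<open>g\<close> turns \<open>u\<close>
    into the unit vector and singles out the wanted entry.\<close>
  then have "u \<bullet> (rev_half n v + lr_block n g *\<^sub>v rev_half n \<rho>) =
      u \<bullet> (?Xu + lr_block n x *\<^sub>v rev_half n v)"
    by simp
  then have "u \<bullet> rev_half n v + u \<bullet> (lr_block n g *\<^sub>v rev_half n \<rho>) =
      u \<bullet> ?Xu + u \<bullet> (lr_block n x *\<^sub>v rev_half n v)"
    using uc Xu by (subst (asm) (1 2) scalar_prod_add_distrib[of _ n])
      (auto intro!: mult_mat_vec_carrier[of _ n n])
  moreover have "u \<bullet> (lr_block n g *\<^sub>v rev_half n \<rho>) = unit_vec n i \<bullet> rev_half n \<rho>"
    using transpose_vec_mult_scalar[of "lr_block n g" n n "rev_half n \<rho>" u] uc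
    by (simp add: e'[symmetric])
  moreover have "transpose_mat (lr_block n x) *\<^sub>v u = u"
    using unitriangular_transpose_inverse[OF xb xinv uc uc] fixed_rowsD(2)[OF fixed xb(1)] by simp
  then have "u \<bullet> (lr_block n x *\<^sub>v rev_half n v) = u \<bullet> rev_half n v"
    using transpose_vec_mult_scalar[of "lr_block n x" n n "rev_half n v" u] uc by simp
  moreover have "unit_vec n i \<bullet> rev_half n \<rho> = y $$ (i, 2 * n - 1 - i)"
    using i c by (simp add: rev_half_def \<rho>_def)
  ultimately show "y $$ (i, 2 * n - 1 - i) = u \<bullet> ?Xu" by simp
qed

lemma finite_unitriangular: "finite (unitriangular k :: 'a::{field,finite} mat set)"
  by (rule finite_subset[OF _ finite_carrier_mat[of k k]]) (auto simp: unitriangular_def)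

lemma group_sylow_Sp_group: "group (sylow_Sp_group n :: 'a::field mat monoid)"
  unfolding sylow_Sp_group_def by (rule subgroup.subgroup_is_group[OF subgroup_sylow_Sp group_GL])

lemma group_unitriangular_group: "group (unitriangular_group k :: 'a::field mat monoid)"
  unfolding unitriangular_group_def
  by (rule subgroup.subgroup_is_group[OF subgroup_unitriangular group_GL])

text \<open>The first half of row \<open>i\<close> labels the cosets of \<open>U_long\<close>, and
  every vector of \<open>lead_vecs n i\<close> occurs as a label.\<close>

lemma \<xi>_long_eq_sum:
  fixes \<theta> :: "'a::{field,finite} \<Rightarrow> complex"
  assumes x: "x \<in> sylow_Sp n" and i: "i < n"
  shows "\<xi>_long \<theta> n (int i + 1) r x =
    (\<Sum>u\<in>lead_vecs n i \<inter> fixed_rows (ul_block n x).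
      \<theta> (r * (u \<bullet> (transpose_mat (ur_block n x) *\<^sub>v u))))"
proof -
  let ?G = "sylow_Sp_group n :: 'a mat monoid"
  let ?F = "\<lambda>u. if u \<in> fixed_rows (ul_block n x)
    then \<theta> (r * (u \<bullet> (transpose_mat (ur_block n x) *\<^sub>v u))) else 0"
  have carrier: "carrier ?G = sylow_Sp n" and mult: "mult ?G = (*)"
    by (simp_all add: sylow_Sp_group_def GL_simps)
  have unitri: "g \<in> unitriangular (2 * n)" if "g \<in> sylow_Sp n" for g :: "'a mat"
    using that by (simp add: sylow_Sp_def)
  have i2: "i < 2 * n" using i by simp
  have "\<xi>_long \<theta> n (int i + 1) r x = (\<Sum>u\<in>lead_vecs n i. ?F u)"
    unfolding \<xi>_long_def
  proof (rule induced_char_fibres[where \<pi> = "\<lambda>g. fst_half n (row g i)", OF group_sylow_Sp_group])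
    show "finite (carrier ?G)"
      unfolding carrier by (rule finite_subset[OF _ finite_unitriangular]) (use unitri in auto)
    show "U_long n (int i + 1) \<subseteq> carrier ?G"
      unfolding carrier by (auto simp: U_long_def)
    show "x \<in> carrier ?G" using x by (simp add: carrier)
    show "(\<lambda>g. fst_half n (row g i)) ` carrier ?G = lead_vecs n i"
      unfolding carrier using fst_half_row_lead[OF unitri i] sylow_Sp_with_row[OF _ i] by blast
  next
    fix k g assume "k \<in> carrier ?G" "g \<in> carrier ?G"
    then have kg: "k \<in> sylow_Sp n" "g \<in> sylow_Sp n" by (simp_all add: carrier)
    note k = unitriangularD(1)[OF unitri[OF kg(1)]] and g = unitriangularD(1)[OF unitri[OF kg(2)]]
    note gb = block_unitriangular[OF unitri[OF kg(2)]]
    have ginv: "ul_block n g * lr_block n g = 1\<^sub>m n"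
      using sylow_Sp_blocks[OF kg(2)] by blast
    have "row k i \<in> carrier_vec (2 * n)" by (rule row_carrier_vec[OF i2 k])
    then have "fst_half n (row (k * g) i) = transpose_mat (ul_block n g) *\<^sub>v fst_half n (row k i)"
      using block_row_mult(1)[OF unitri[OF kg(2)]] by (simp add: row_mult_eq_transpose[OF k g i2])
    moreover have "fst_half n (row g i) = transpose_mat (ul_block n g) *\<^sub>v unit_vec n i"
      using transpose_mult_unit_vec[of "ul_block n g" n i] i row_ul_ur_block[OF g i] by simp
    ultimately have "fst_half n (row (k * g) i) = fst_half n (row g i) \<longleftrightarrow>
        fst_half n (row k i) = unit_vec n i"
      using unitriangular_transpose_inverse[OF gb ginv _ block_carrier(4)]
      by (metis block_carrier(4) unit_vec_carrier)
    then show "fst_half n (row (k \<otimes>\<^bsub>?G\<^esub> g) i) = fst_half n (row g i) \<longleftrightarrow> k \<in> U_long n (int i + 1)"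
      using U_long_iff[OF i, of k] kg by (simp add: mult)
  next
    fix g y assume "g \<in> carrier ?G" "y \<in> carrier ?G" "y \<otimes>\<^bsub>?G\<^esub> g = g \<otimes>\<^bsub>?G\<^esub> x"
    then have gy: "g \<in> sylow_Sp n" "y \<in> sylow_Sp n" "y * g = g * x"
      by (simp_all add: carrier mult)
    show "(if y \<in> U_long n (int i + 1) then entry_char \<theta> n (int i + 1) r y else 0) =
        ?F (fst_half n (row g i))"
      using sylow_Sp_conj_entry[OF x gy i] U_long_iff[OF i, of y] gy i
      by (simp add: entry_char_def entry_def pos_simps)
  qed
  also have "\<dots> = (\<Sum>u\<in>lead_vecs n i \<inter> fixed_rows (ul_block n x).
      \<theta> (r * (u \<bullet> (transpose_mat (ur_block n x) *\<^sub>v u))))"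
    by (rule sum.inter_restrict[symmetric]) simp
  finally show ?thesis .
qed

section \<open>The supercharacter as a double sum\<close>

text \<open>Since the diagonal of \<open>A\<close> cancels, entry \<open>k\<close> of
  \<open>A w - w\<close> involves only entries of \<open>w\<close> beyond \<open>k\<close>.\<close>

lemma unitriangular_mult_tail:
  assumes A: "A \<in> unitriangular n" and w: "w \<in> carrier_vec n" "w' \<in> carrier_vec n"
    and eq: "\<And>k. i < k \<Longrightarrow> k < n \<Longrightarrow> w $ k = w' $ k" and k: "i \<le> k" "k < n"
  shows "(A *\<^sub>v w - w) $ k = (A *\<^sub>v w' - w') $ k"
proof -
  note AD = unitriangularD[OF A]
  have *: "(A *\<^sub>v v - v) $ k = (\<Sum>l\<in>{k<..<n}. A $$ (k, l) * v $ l)" if v: "v \<in> carrier_vec n" for v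
  proof -
    have "(A *\<^sub>v v) $ k = (\<Sum>l<n. A $$ (k, l) * v $ l)"
      using AD(1) v k by (auto simp: scalar_prod_def atLeast0LessThan)
    also have "\<dots> = (\<Sum>l\<in>insert k {k<..<n}. A $$ (k, l) * v $ l)"
      using k AD(2) by (intro sum.mono_neutral_right) auto
    also have "\<dots> = v $ k + (\<Sum>l\<in>{k<..<n}. A $$ (k, l) * v $ l)"
      using AD(3) k by simp
    finally show ?thesis using v k AD(1) by simp
  qed
  show ?thesis
    unfolding *[OF w(1)] *[OF w(2)] using eq k by (intro sum.cong refl) auto
qed

text \<open>Cosets of \<open>\<zeta>_sub\<close> are labelled by the part of row \<open>i\<close>
  before position \<open>2 * n - 1 - i\<close>: a first half \<open>u\<close> and the reversed
  second half truncated to a tail vector \<open>w\<close>. In the full unitriangular group the two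
  vary independently.\<close>

lemma \<zeta>_super_eq_sum:
  fixes \<theta> :: "'a::{field,finite} \<Rightarrow> complex"
  assumes x: "x \<in> unitriangular (2 * n)" and i: "i < n"
  defines "\<eta> \<equiv> \<lambda>u w. transpose_mat (ur_block n x) *\<^sub>v u + (lr_block n x *\<^sub>v w - w)"
  shows "\<zeta>_super \<theta> n (int i + 1) r x =
    (\<Sum>u\<in>lead_vecs n i \<inter> fixed_rows (ul_block n x). \<Sum>w\<in>tail_vecs n i.
      if \<forall>k. i < k \<and> k < n \<longrightarrow> \<eta> u w $ k = 0 then \<theta> (r * \<eta> u w $ i) else 0)"
proof -
  let ?G = "unitriangular_group (2 * n) :: 'a mat monoid"
  let ?A = "ul_block n x"
  let ?c = "2 * n - 1 - i"
  \<comment> \<open>Reversed places up to \<open>i\<close> are the positions from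
    \<open>2 * n - 1 - i\<close> onwards, which the subgroup leaves free.\<close>
  define \<tau> where "\<tau> = (\<lambda>w :: 'a vec. vec n (\<lambda>k. if k \<le> i then 0 else w $ k))"
  define \<pi> where "\<pi> = (\<lambda>g. (fst_half n (row g i), \<tau> (rev_half n (row g i))))"
  let ?Z = "\<lambda>u w. \<forall>k. i < k \<and> k < n \<longrightarrow> \<eta> u w $ k = 0"
  let ?H = "\<lambda>u w. if ?Z u w then \<theta> (r * \<eta> u w $ i) else 0"
  let ?F = "\<lambda>(u, w). if u \<in> fixed_rows ?A then ?H u w else 0"
  have carrier: "carrier ?G = unitriangular (2 * n)" and mult: "mult ?G = (*)"
    by (simp_all add: unitriangular_group_def GL_simps)
  have i2: "i < 2 * n" "?c < 2 * n" using i by simp_all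
  note xc = unitriangularD(1)[OF x]
  \<comment> \<open>Positions below \<open>?c\<close> are those of the first half together with the
    reversed places beyond \<open>i\<close>.\<close>
  have prefix: "(\<forall>k<?c. v $ k = 0) \<longleftrightarrow>
      (\<forall>k<n. v $ k = 0) \<and> (\<forall>k. i < k \<and> k < n \<longrightarrow> v $ (2 * n - 1 - k) = 0)" (is "?L \<longleftrightarrow> ?R")
    for v :: "'a vec"
  proof
    assume ?R
    show ?L
    proof (intro allI impI)
      fix k assume k: "k < ?c"
      show "v $ k = 0"
      proof (cases "k < n")
        case False
        then have "i < 2 * n - 1 - k" "2 * n - 1 - k < n" "2 * n - 1 - (2 * n - 1 - k) = k"
          using k by auto
        then show ?thesis using \<open>?R\<close> by metis
      qed (use \<open>?R\<close> in simp)
    qed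
  qed (use i in auto)
  have \<pi>_eq: "\<pi> g = \<pi> h \<longleftrightarrow> (\<forall>k<?c. (row g i - row h i) $ k = 0)"
    if "g \<in> unitriangular (2 * n)" "h \<in> unitriangular (2 * n)" for g h
  proof -
    have "\<pi> g = \<pi> h \<longleftrightarrow> (\<forall>k<n. row g i $ k = row h i $ k) \<and>
        (\<forall>k. i < k \<and> k < n \<longrightarrow> row g i $ (2 * n - 1 - k) = row h i $ (2 * n - 1 - k))"
      by (auto simp: \<pi>_def \<tau>_def fst_half_def rev_half_def vec_eq_iff)
    then show ?thesis
      unfolding prefix using unitriangularD(1)[OF that(1)] unitriangularD(1)[OF that(2)] by auto
  qed
  have "\<zeta>_super \<theta> n (int i + 1) r x = (\<Sum>p\<in>lead_vecs n i \<times> tail_vecs n i. ?F p)"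
    unfolding \<zeta>_super_def
  proof (rule induced_char_fibres[where \<pi> = \<pi>, OF group_unitriangular_group])
    show "finite (carrier ?G)"
      unfolding carrier by (rule finite_unitriangular)
    show "\<zeta>_sub n (int i + 1) \<subseteq> carrier ?G"
      unfolding carrier by (auto simp: \<zeta>_sub_def)
    show "x \<in> carrier ?G" using x by (simp add: carrier)
    show "\<pi> ` carrier ?G = lead_vecs n i \<times> tail_vecs n i"
      unfolding carrier
    proof (intro subset_antisym subsetI)
      fix p assume "p \<in> \<pi> ` unitriangular (2 * n)"
      then show "p \<in> lead_vecs n i \<times> tail_vecs n i"
        using fst_half_row_lead[OF _ i] by (auto simp: \<pi>_def \<tau>_def tail_vecs_def)
    next
      fix p :: "'a vec \<times> 'a vec" assume "p \<in> lead_vecs n i \<times> tail_vecs n i"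
      then obtain u w where p: "p = (u, w)" "u \<in> lead_vecs n i" "w \<in> tail_vecs n i" by auto
      define v where "v = vec (2 * n) (\<lambda>k. if k < n then u $ k else w $ (2 * n - 1 - k))"
      have "v \<in> lead_vecs (2 * n) i"
        using p i by (auto simp: v_def lead_vecs_def)
      then obtain g where g: "g \<in> unitriangular (2 * n)" "row g i = v"
        using unitriangular_with_row i2(1) by blast
      have "fst_half n v = u"
        using p by (auto simp: fst_half_def v_def lead_vecs_def intro!: eq_vecI)
      moreover have "\<tau> (rev_half n v) = w"
        using p by (auto simp: rev_half_def \<tau>_def v_def tail_vecs_def intro!: eq_vecI)
      ultimately have "\<pi> g = p" by (simp add: \<pi>_def g p)
      then show "p \<in> \<pi> ` unitriangular (2 * n)" using g by auto
    qed
  next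
    fix k g assume "k \<in> carrier ?G" "g \<in> carrier ?G"
    then have kg: "k \<in> unitriangular (2 * n)" "g \<in> unitriangular (2 * n)" by (simp_all add: carrier)
    note k = unitriangularD(1)[OF kg(1)] and g = unitriangularD(1)[OF kg(2)]
    \<comment> \<open>The difference of the rows of \<open>k g\<close> and \<open>g\<close> is the
      image under \<open>g\<close> of a vector that has a zero prefix exactly when \<open>k\<close>
      lies in the subgroup.\<close>
    have "transpose_mat g *\<^sub>v (row k i - unit_vec (2 * n) i) = row (k * g) i - row g i"
      using row_carrier_vec[OF i2(1) k] k g i2
      by (simp add: mult_minus_distrib_mat_vec[of _ "2 * n" "2 * n"]
        transpose_mult_unit_vec row_mult_eq_transpose[OF k g] del: row_mult)
    moreover have "row k i - unit_vec (2 * n) i \<in> carrier_vec (2 * n)"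
      using row_carrier_vec[OF i2(1) k] by simp
    ultimately have "(\<forall>l<?c. (row (k * g) i - row g i) $ l = 0) \<longleftrightarrow>
        (\<forall>l<?c. (row k i - unit_vec (2 * n) i) $ l = 0)"
      using transpose_unitriangular_prefix(1)[OF kg(2), of "row k i - unit_vec (2 * n) i" ?c] i2
      by (metis less_imp_le)
    then show "\<pi> (k \<otimes>\<^bsub>?G\<^esub> g) = \<pi> g \<longleftrightarrow> k \<in> \<zeta>_sub n (int i + 1)"
      unfolding mult \<pi>_eq[OF unitriangular_mult[OF kg] kg(2)] \<zeta>_sub_iff[OF i] using kg by simp
  next
    fix g y assume "g \<in> carrier ?G" "y \<in> carrier ?G" "y \<otimes>\<^bsub>?G\<^esub> g = g \<otimes>\<^bsub>?G\<^esub> x"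
    then have gy: "g \<in> unitriangular (2 * n)" "y \<in> unitriangular (2 * n)" and eq: "y * g = g * x"
      by (simp_all add: carrier mult)
    note g = unitriangularD(1)[OF gy(1)] and y = unitriangularD(1)[OF gy(2)]
    define v where "v = row g i"
    define \<rho> where "\<rho> = row y i - unit_vec (2 * n) i"
    define u where "u = fst_half n v"
    define w where "w = \<tau> (rev_half n v)"
    define \<delta> where "\<delta> = transpose_mat x *\<^sub>v v - v"
    note yc = row_carrier_vec[OF i2(1) y]
    have vc: "v \<in> carrier_vec (2 * n)" and \<rho>c: "\<rho> \<in> carrier_vec (2 * n)"
      using row_carrier_vec[OF i2(1) g] yc by (auto simp: v_def \<rho>_def)
    have uc: "u \<in> carrier_vec n" by (simp add: u_def)
    have wc: "w \<in> carrier_vec n" by (simp add: w_def \<tau>_def)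
    \<comment> \<open>This is \<open>y g = g x\<close> in row \<open>i\<close> with row
      \<open>i\<close> of \<open>g\<close> subtracted. Hence \<open>\<rho>\<close> and
      \<open>\<delta>\<close> have the same leading zeros, and the same entry at \<open>?c\<close>
      once all earlier ones vanish.\<close>
    have \<delta>: "transpose_mat g *\<^sub>v \<rho> = \<delta>"
      using y g xc i2 yc row_mult_eq_transpose[OF y g i2(1)] row_mult_eq_transpose[OF g xc i2(1)]
      by (simp add: \<rho>_def \<delta>_def v_def mult_minus_distrib_mat_vec[of _ "2 * n" "2 * n"]
        transpose_mult_unit_vec eq del: row_mult)
    have \<delta>_fst: "\<delta> $ k = (transpose_mat ?A *\<^sub>v u - u) $ k" if k: "k < n" for k
      using arg_cong[OF block_row_mult(1)[OF x vc], of "\<lambda>z. z $ k"] k vc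
      by (simp add: \<delta>_def u_def fst_half_def ul_block_def)
    \<comment> \<open>The truncation does no harm from place \<open>i\<close> on. The case
      \<open>k = i\<close> is included because it yields the value of the character.\<close>
    have \<delta>_rev: "\<delta> $ (2 * n - 1 - k) = \<eta> u w $ k" if k: "i \<le> k" "k < n" for k
    proof -
      have "\<delta> $ (2 * n - 1 - k) = (transpose_mat (ur_block n x) *\<^sub>v u) $ k +
          (lr_block n x *\<^sub>v rev_half n v - rev_half n v) $ k"
        using arg_cong[OF block_row_mult(2)[OF x vc], of "\<lambda>z. z $ k"] k vc
        by (simp add: \<delta>_def u_def rev_half_def lr_block_def)
      also have "(lr_block n x *\<^sub>v rev_half n v - rev_half n v) $ k = (lr_block n x *\<^sub>v w - w) $ k"
        using k by (intro unitriangular_mult_tail[OF block_unitriangular(2)[OF x] block_carrier(5) wc])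
          (auto simp: w_def \<tau>_def)
      finally show ?thesis
        using k wc by (simp add: \<eta>_def lr_block_def)
    qed
    have sub_iff: "y \<in> \<zeta>_sub n (int i + 1) \<longleftrightarrow> (\<forall>k<?c. \<rho> $ k = 0)"
      unfolding \<zeta>_sub_iff[OF i] \<rho>_def using gy(2) by blast
    also have "\<dots> \<longleftrightarrow> (\<forall>k<?c. \<delta> $ k = 0)"
      using transpose_unitriangular_prefix(1)[OF gy(1) \<rho>c less_imp_le[OF i2(2)]]
      unfolding \<delta> by (rule sym)
    also have "\<dots> \<longleftrightarrow> (\<forall>k<n. (transpose_mat ?A *\<^sub>v u - u) $ k = 0) \<and> ?Z u w"
      unfolding prefix using \<delta>_fst \<delta>_rev by auto
    also have "(\<forall>k<n. (transpose_mat ?A *\<^sub>v u - u) $ k = 0) \<longleftrightarrow> u \<in> fixed_rows ?A"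
      using uc by (auto simp: fixed_rows_def ul_block_def vec_eq_iff)
    finally have iff: "y \<in> \<zeta>_sub n (int i + 1) \<longleftrightarrow> u \<in> fixed_rows ?A \<and> ?Z u w" .
    have val: "entry_char \<theta> n (int i + 1) r y = \<theta> (r * \<eta> u w $ i)" if "y \<in> \<zeta>_sub n (int i + 1)"
    proof -
      have "\<forall>k<?c. \<rho> $ k = 0"
        using that sub_iff by blast
      then have "\<rho> $ ?c = \<eta> u w $ i"
        using transpose_unitriangular_prefix(2)[OF gy(1) \<rho>c, of ?c] i2 \<delta> \<delta>_rev[of i] i by simp
      moreover have "\<rho> $ ?c = y $$ (i, ?c)"
        using y i by (simp add: \<rho>_def)
      ultimately show ?thesis
        using i by (simp add: entry_char_def entry_def pos_simps)
    qed
    have "\<pi> g = (u, w)" by (simp add: \<pi>_def u_def w_def v_def)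
    then show "(if y \<in> \<zeta>_sub n (int i + 1) then entry_char \<theta> n (int i + 1) r y else 0) = ?F (\<pi> g)"
      using iff val by auto
  qed
  also have "\<dots> = (\<Sum>u\<in>lead_vecs n i. \<Sum>w\<in>tail_vecs n i. if u \<in> fixed_rows ?A then ?H u w else 0)"
    by (simp only: sum.cartesian_product)
  also have "\<dots> = (\<Sum>u\<in>lead_vecs n i. if u \<in> fixed_rows ?A then \<Sum>w\<in>tail_vecs n i. ?H u w else 0)"
    by (intro sum.cong refl) simp
  also have "\<dots> = (\<Sum>u\<in>lead_vecs n i \<inter> fixed_rows ?A. \<Sum>w\<in>tail_vecs n i. ?H u w)"
    by (rule sum.inter_restrict[symmetric]) simp
  finally show ?thesis .
qed

section \<open>The restriction formula\<close>

theorem proposition3p6: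
  fixes p e n :: nat
    and \<theta> :: "'a::{field,finite} \<Rightarrow> complex"
    and i :: int
    and r :: 'a
  assumes "prime p" and "p \<ge> 3" and "e \<ge> 1" and "card (UNIV :: 'a set) = p ^ e"
    and "n \<ge> 1"
    and "\<And>a. \<theta> a \<noteq> 0"
    and "\<And>a b. \<theta> (a + b) = \<theta> a * \<theta> b"
    and "\<exists>a. \<theta> a \<noteq> 1"
    and "1 \<le> i" and "i \<le> int n"
    and "r \<noteq> 0"
  shows "\<forall>x\<in>sylow_Sp n.
    \<zeta>_super \<theta> n i r x =
      \<xi>_long \<theta> n i r x
      + 2 * (\<Sum>j\<in>{i<..int n}. \<Sum>s\<in>(\<lambda>t. - inverse r * t) ` nonzero_squares.
               \<xi>_long \<theta> n i r x * \<xi>_long \<theta> n j s x)"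
proof
  fix x :: "'a mat" assume x: "x \<in> sylow_Sp n"
  interpret add_char \<theta>
    using assms(6-8) by unfold_locales auto
  define k where "k = nat (i - 1)"
  have i: "i = int k + 1" and k: "k < n"
    using assms(9,10) by (auto simp: k_def)
  \<comment> \<open>Characteristic 2 would make 2 divide the field order \<open>p ^ e\<close>,
    forcing \<open>p = 2\<close>.\<close>
  have two: "(2::'a) \<noteq> 0"
  proof
    assume "(2::'a) = 0"
    then have "CHAR('a) dvd 2"
      using of_nat_eq_0_iff_char_dvd[where 'a = 'a, of 2] by simp
    then have "CHAR('a) = 2"
      using CHAR_not_1[where 'a = 'a] prime_nat_iff[of 2] two_is_prime_nat by (metis One_nat_def)
    then have "2 dvd p ^ e"
      using CHAR_dvd_CARD[where 'a = 'a] assms(4) by simp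
    then have "2 dvd p" by (rule prime_dvd_power[OF two_is_prime_nat])
    then have "2 = p" by (rule primes_dvd_imp_eq[OF two_is_prime_nat assms(1)])
    then show False using assms(2) by simp
  qed
  have xu: "x \<in> unitriangular (2 * n)" using x by (simp add: sylow_Sp_def)
  obtain Y where inv: "ul_block n x * lr_block n x = 1\<^sub>m n" and Y: "Y \<in> carrier_mat n n"
    and sym: "transpose_mat Y = Y" and ur: "ur_block n x = ul_block n x * Y"
    by (rule sylow_Sp_blocks[OF x])
  note b = block_unitriangular[OF xu]
  let ?A = "ul_block n x"
  define Q where "Q = (\<lambda>u. u \<bullet> (Y *\<^sub>v u))"
  \<comment> \<open>By symmetry of \<open>Y\<close> the transposed block is \<open>Y\<close> times
    the transpose of \<open>?A\<close>, and the latter fixes \<open>u\<close>.\<close>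
  have ur_fixed: "transpose_mat (ur_block n x) *\<^sub>v u = Y *\<^sub>v u" if u: "u \<in> fixed_rows ?A" for u
  proof -
    have "transpose_mat (ur_block n x) = Y * transpose_mat ?A"
      unfolding ur using transpose_mult[OF block_carrier(1) Y] sym by simp
    then show ?thesis
      using fixed_rowsD[OF u b(1)] Y by (simp add: assoc_mult_mat_vec[of _ n n _ n])
  qed
  have \<xi>: "\<xi>_long \<theta> n (int j + 1) s x = (\<Sum>u\<in>lead_vecs n j \<inter> fixed_rows ?A. \<theta> (s * Q u))"
    if "j < n" for j s
    unfolding \<xi>_long_eq_sum[OF x that] Q_def by (intro sum.cong refl) (simp add: ur_fixed)
  have "\<zeta>_super \<theta> n i r x = (\<Sum>u\<in>lead_vecs n k \<inter> fixed_rows ?A.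
      \<theta> (r * Q u) * (\<Sum>t\<in>tail_vecs n k \<inter> fixed_rows ?A. \<theta> (t \<bullet> (Y *\<^sub>v u))))"
    unfolding i \<zeta>_super_eq_sum[OF xu k] Q_def
    by (intro sum.cong refl) (simp only: Int_iff ur_fixed sum_tail_vecs_cond[OF b inv Y k])
  \<comment> \<open>Completing the square makes the inner sum independent of \<open>u\<close>, so
    the long root character splits off as a factor.\<close>
  also have "\<dots> = \<xi>_long \<theta> n i r x *
      (\<Sum>t\<in>tail_vecs n k \<inter> fixed_rows ?A. \<theta> (- inverse r * Q t))"
    unfolding i \<xi>[OF k] unfolding Q_def
    by (rule sum_lead_tail_square[OF b(1) Y sym k assms(11) two])
  also have "(\<Sum>t\<in>tail_vecs n k \<inter> fixed_rows ?A. \<theta> (- inverse r * Q t)) =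
      1 + 2 * (\<Sum>j\<in>{k<..<n}. \<Sum>s\<in>(\<lambda>t. - inverse r * t) ` nonzero_squares.
        \<Sum>u\<in>lead_vecs n j \<inter> fixed_rows ?A. \<theta> (s * Q u))"
    unfolding Q_def by (rule sum_tail_fixed_rows_square[OF b(1) Y assms(11) two])
  also have "(\<Sum>j\<in>{k<..<n}. \<Sum>s\<in>(\<lambda>t. - inverse r * t) ` nonzero_squares.
        \<Sum>u\<in>lead_vecs n j \<inter> fixed_rows ?A. \<theta> (s * Q u)) =
      (\<Sum>j\<in>{k<..<n}. \<Sum>s\<in>(\<lambda>t. - inverse r * t) ` nonzero_squares.
        \<xi>_long \<theta> n (int j + 1) s x)"
    by (intro sum.cong refl) (simp add: \<xi>)
  \<comment> \<open>Passage from zero-based positions back to the indices of the roots.\<close>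
  also have "(\<Sum>j\<in>{k<..<n}. \<Sum>s\<in>(\<lambda>t. - inverse r * t) ` nonzero_squares.
        \<xi>_long \<theta> n (int j + 1) s x) =
      (\<Sum>j\<in>{i<..int n}. \<Sum>s\<in>(\<lambda>t. - inverse r * t) ` nonzero_squares. \<xi>_long \<theta> n j s x)"
    by (rule sum.reindex_bij_witness[where j = "\<lambda>j. int j + 1" and i = "\<lambda>j. nat (j - 1)"])
      (auto simp: i)
  finally show "\<zeta>_super \<theta> n i r x =
      \<xi>_long \<theta> n i r x
      + 2 * (\<Sum>j\<in>{i<..int n}. \<Sum>s\<in>(\<lambda>t. - inverse r * t) ` nonzero_squares.
               \<xi>_long \<theta> n i r x * \<xi>_long \<theta> n j s x)"
    by (simp add: algebra_simps sum_distrib_left)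
qed

end
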